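(* Let $F(x,y) = b_3 x^3 + b_2 x^2 y + b_1 x y^2 + b_0 y^3$ be a binary cubic form with integer coefficients, $b_3 \neq 0$, and non-zero discriminant $\Delta(F)$. Then: (1) $\operatorname{Aut} F = \{I_{2\times 2}\}$ if and only if $F$ is irreducible over $\mathbb{Q}$ and $\Delta(F)$ is not a square. (2) $\operatorname{Aut} F$ is generated by $\mathcal{N}_{q_F} \in \operatorname{GL}_2(\mathbb{Q})$ and is isomorphic to the cyclic group $\mathcal{C}_3$ of order $3$ if and only if $F$ is irreducible over $\mathbb{Q}$ and $\Delta(F)$ is a square. (3) $\operatorname{Aut} F$ is generated by $\mathcal{T}_\theta$ for the unique rational root $\theta$ of $F(x,1)$ and is isomorphic to the cyclic group $\mathcal{C}_2$ of order $2$ if and only if $F$ has exactly one rational linear factor over $\mathbb{Q}$, corresponding to the root $\theta$. (4) $\operatorname{Aut} F = \{I_{2\times 2}, \mathcal{N}_{q_F}, \mathcal{N}_{q_F}^2, \mathcal{T}_{\theta_1}, \mathcal{T}_{\theta_2}, \mathcal{T}_{\theta_3}\} \cong \mathcal{D}_3$ (the dihedral group of order $6$), where $\theta_1,\theta_2,\theta_3$ are the roots of $F(x,1)$, if and only if $F$ splits completely over $\mathbb{Q}$.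
   Context: For $T = \begin{pmatrix} t_1 & t_2 \\ t_3 & t_4\end{pmatrix}$ put $F_T(x,y) = F(t_1 x + t_2 y, t_3 x + t_4 y)$, and $\operatorname{Aut} F = \{T \in \operatorname{GL}_2(\mathbb{Q}) : F_T = F\}$. $\Delta(F) = b_2^2b_1^2 - 4b_3b_1^3 - 4b_2^3b_0 - 27b_3^2b_0^2 + 18b_3b_2b_1b_0$ is the discriminant of $F$, and for a quadratic form $f = ax^2+bxy+cy^2$, $\Delta(f) = b^2-4ac$. The Hessian covariant of $F$ is $q_F(x,y) = Ax^2+Bxy+Cy^2$ with $A = b_2^2 - 3b_3b_1$, $B = b_2b_1 - 9b_3b_0$, $C = b_1^2 - 3b_2b_0$; it satisfies $\Delta(q_F) = -3\Delta(F)$. For a root $\theta$ of $F(x,1)$, the Julia covariant is $J_\theta(x,y) = h_2x^2+h_1xy+h_0y^2$ with \[h_2 = 9b_3^2\theta^2 + 6b_3b_2\theta + 6b_3b_1 - b_2^2,\] \[h_1 = 6b_3b_2\theta^2 + 6(b_2^2 - b_3b_1)\theta + 2b_2b_1,\] \[h_0 = 3b_3b_1\theta^2 + 3(b_2b_1 - 3b_3b_0)\theta + 2b_1^2 - 3b_2b_0.\] For a binary quadratic form $f = ax^2+bxy+cy^2$ with complex coefficients (and, for $\mathcal{N}_f$, non-zero discriminant) put \[\mathcal{M}_f = \begin{pmatrix} b & 2c \\ -2a & -b\end{pmatrix},\qquad \mathcal{N}_f = \frac{1}{2\Delta(f)}\begin{pmatrix} b\sqrt{-3\Delta(f)} - \Delta(f)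 & 2c\sqrt{-3\Delta(f)} \\ -2a\sqrt{-3\Delta(f)} & -b\sqrt{-3\Delta(f)} - \Delta(f)\end{pmatrix},\] where the square root of a complex number is the principal one (non-negative real part, and positive imaginary part if the real part vanishes). Finally \[\mathcal{T}_\theta = \frac{-1}{6\Delta(F)}\mathcal{M}_{J_\theta}\mathcal{M}_{q_F}.\] *)

theory Defs
  imports
    "HOL-Analysis.Analysis"
    "HOL-Algebra.Elementary_Groups"
    "HOL-Computational_Algebra.Computational_Algebra"
begin

text \<open>
  \<open>Cubic b3 b2 b1 b0\<close> stands for \<open>b3 x^3 + b2 x^2 y + b1 x y^2 + b0 y^3\<close> and
  \<open>Quadratic a b c\<close> for \<open>a x^2 + b x y + c y^2\<close>.
\<close>

datatype int_cubic = Cubic int int int int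

datatype 'a quadratic = Quadratic 'a 'a 'a

fun eval_cubic :: "int_cubic \<Rightarrow> 'a::comm_ring_1 \<Rightarrow> 'a \<Rightarrow> 'a" where
  "eval_cubic (Cubic b3 b2 b1 b0) x y =
     of_int b3 * x ^ 3 + of_int b2 * x ^ 2 * y + of_int b1 * x * y ^ 2 + of_int b0 * y ^ 3"

fun cubic_disc :: "int_cubic \<Rightarrow> int" where
  "cubic_disc (Cubic b3 b2 b1 b0) =
     b2 ^ 2 * b1 ^ 2 - 4 * b3 * b1 ^ 3 - 4 * b2 ^ 3 * b0 - 27 * b3 ^ 2 * b0 ^ 2
     + 18 * b3 * b2 * b1 * b0"

fun quadratic_disc :: "'a::comm_ring_1 quadratic \<Rightarrow> 'a" where
  "quadratic_disc (Quadratic a b c) = b ^ 2 - 4 * a * c"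

fun hessian :: "int_cubic \<Rightarrow> complex quadratic" where
  "hessian (Cubic b3 b2 b1 b0) =
     Quadratic (of_int (b2 ^ 2 - 3 * b3 * b1))
               (of_int (b2 * b1 - 9 * b3 * b0))
               (of_int (b1 ^ 2 - 3 * b2 * b0))"

fun julia :: "int_cubic \<Rightarrow> complex \<Rightarrow> complex quadratic" where
  "julia (Cubic b3 b2 b1 b0) \<theta> =
     (let b3 = of_int b3; b2 = of_int b2; b1 = of_int b1; b0 = of_int b0 in
      Quadratic
        (9 * b3 ^ 2 * \<theta> ^ 2 + 6 * b3 * b2 * \<theta> + 6 * b3 * b1 - b2 ^ 2)
        (6 * b3 * b2 * \<theta> ^ 2 + 6 * (b2 ^ 2 - b3 * b1) * \<theta> + 2 * b2 * b1)
        (3 * b3 * b1 * \<theta> ^ 2 + 3 * (b2 * b1 - 3 * b3 * b0) * \<theta> + 2 * b1 ^ 2 - 3 * b2 * b0))"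

fun mat_M :: "complex quadratic \<Rightarrow> complex^2^2" where
  "mat_M (Quadratic a b c) = vector [vector [b, 2 * c], vector [- 2 * a, - b]]"

fun mat_N :: "complex quadratic \<Rightarrow> complex^2^2" where
  "mat_N (Quadratic a b c) =
     (let D = quadratic_disc (Quadratic a b c); s = csqrt (- 3 * D) in
      map_matrix ((*) (1 / (2 * D)))
        (vector [vector [b * s - D, 2 * c * s],
                 vector [- 2 * a * s, - b * s - D]]))"

definition mat_T :: "int_cubic \<Rightarrow> complex \<Rightarrow> complex^2^2" where
  "mat_T F \<theta> =
     map_matrix ((*) (- 1 / (6 * of_int (cubic_disc F)))) (mat_M (julia F \<theta>) ** mat_M (hessian F))"

text \<open>
  The polynomial ring \<open>Q[x,y]\<close> is represented as \<open>rat poly poly\<close>, with \<open>x\<close> the outer and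
  \<open>y\<close> the inner variable.
\<close>

definition poly_x :: "rat poly poly" where "poly_x = [:0, 1:]"
definition poly_y :: "rat poly poly" where "poly_y = [:[:0, 1:]:]"

definition linear_form :: "rat \<Rightarrow> rat \<Rightarrow> rat poly poly" where
  "linear_form a b = [:[:a:]:] * poly_x + [:[:b:]:] * poly_y"

definition form :: "int_cubic \<Rightarrow> rat poly poly" where
  "form F = eval_cubic F poly_x poly_y"

definition form_subst :: "int_cubic \<Rightarrow> rat^2^2 \<Rightarrow> rat poly poly" where
  "form_subst F T =
     eval_cubic F (linear_form (T $ 1 $ 1) (T $ 1 $ 2)) (linear_form (T $ 2 $ 1) (T $ 2 $ 2))"

definition GL2Q :: "(rat^2^2) monoid" where
  "GL2Q = \<lparr>carrier = {T. invertible T}, monoid.mult = (**), one = mat 1\<rparr>"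

definition Aut :: "int_cubic \<Rightarrow> (rat^2^2) set" where
  "Aut F = {T \<in> carrier GL2Q. form_subst F T = form F}"

definition Aut_group :: "int_cubic \<Rightarrow> (rat^2^2) monoid" where
  "Aut_group F = GL2Q\<lparr>carrier := Aut F\<rparr>"

text \<open>
  The matrices \<open>N\<close> and \<open>T\<close> of the covariants are a priori complex; being generated by such a
  matrix \<open>M\<close> includes that \<open>M\<close> is (the image of) an element of \<open>GL_2(Q)\<close>.
\<close>

abbreviation complex_mat :: "rat^2^2 \<Rightarrow> complex^2^2" where
  "complex_mat \<equiv> map_matrix of_rat"

definition Aut_generated_by :: "int_cubic \<Rightarrow> complex^2^2 \<Rightarrow> bool" where
  "Aut_generated_by F M \<longleftrightarrow>
     (\<exists>T \<in> carrier GL2Q. complex_mat T = M \<and> Aut F = generate GL2Q {T})"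

text \<open>
  Linear factors are counted up to non-zero constants.  The factor \<open>a x + b y\<close> corresponds to
  the root \<open>\<theta>\<close> of \<open>F(x,1)\<close> if it vanishes at \<open>(\<theta>, 1)\<close>.
\<close>

definition rational_linear_factor :: "int_cubic \<Rightarrow> rat \<Rightarrow> rat \<Rightarrow> bool" where
  "rational_linear_factor F a b \<longleftrightarrow> (a, b) \<noteq> (0, 0) \<and> linear_form a b dvd form F"

definition sole_rational_linear_factor :: "int_cubic \<Rightarrow> complex \<Rightarrow> bool" where
  "sole_rational_linear_factor F \<theta> \<longleftrightarrow>
     (\<exists>a b. rational_linear_factor F a b \<and>
            (\<forall>c d. rational_linear_factor F c d \<longrightarrow> (\<exists>k. c = k * a \<and> d = k * b)) \<and>
            of_rat a * \<theta> + of_rat b = 0)"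

definition splits_over_rat :: "int_cubic \<Rightarrow> bool" where
  "splits_over_rat F \<longleftrightarrow>
     (\<exists>a1 c1 a2 c2 a3 c3.
        form F = linear_form a1 c1 * linear_form a2 c2 * linear_form a3 c3)"

text \<open>
  The dihedral group of order \<open>2n\<close>: \<open>(i, e)\<close> stands for \<open>r^i s^e\<close>, with \<open>r\<close> of order \<open>n\<close>,
  \<open>s\<close> of order 2 and \<open>s r = r^(-1) s\<close>.
\<close>

definition dihedral_group :: "nat \<Rightarrow> (int \<times> bool) monoid" where
  "dihedral_group n =
     \<lparr>carrier = {0..<int n} \<times> UNIV,
      monoid.mult = (\<lambda>(i, e) (j, f). ((if e then i - j else i + j) mod int n, e \<noteq> f)),
      one = (0, False)\<rparr>"

lemma group_GL2Q: "group GL2Q"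
proof (rule groupI)
  fix S T U assume "S \<in> carrier GL2Q" "T \<in> carrier GL2Q"
  then show "S \<otimes>\<^bsub>GL2Q\<^esub> T \<in> carrier GL2Q"
    by (simp add: GL2Q_def invertible_mult)
next
  fix S assume "S \<in> carrier GL2Q"
  then show "\<exists>T \<in> carrier GL2Q. T \<otimes>\<^bsub>GL2Q\<^esub> S = \<one>\<^bsub>GL2Q\<^esub>"
    by (auto simp: GL2Q_def invertible_def)
qed (auto simp: GL2Q_def matrix_mul_assoc invertible_def intro: exI[of _ "mat 1"])

lemma group_dihedral_group:
  assumes "n > 0"
  shows "group (dihedral_group n)"
proof (rule groupI)
  fix u assume u: "u \<in> carrier (dihedral_group n)"
  obtain i e where ie: "u = (i, e)" by fastforce
  show "\<exists>v \<in> carrier (dihedral_group n). v \<otimes>\<^bsub>dihedral_group n\<^esub> u = \<one>\<^bsub>dihedral_group n\<^esub>"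
    by (rule bexI[of _ "(if e then i else (- i) mod int n, e)"])
       (use u ie assms in \<open>auto simp: dihedral_group_def mod_simps\<close>)
qed (use assms in \<open>auto simp: dihedral_group_def mod_simps algebra_simps\<close>)

end

theory Submission
  imports Defs
begin

text \<open>
  A matrix preserving \<open>F\<close> permutes its three roots \<open>u, v, w\<close>.  Two complex matrices with real
  determinant that preserve \<open>F\<close> and induce the same permutation differ by a scalar \<open>c\<close> with
  \<open>c\<^sup>3 = 1\<close> and \<open>c\<^sup>2\<close> real, so they are equal.  Rewriting the covariants in terms of the roots
  shows that \<open>N\<close> is a 3-cycle of determinant \<open>1\<close> and that \<open>T\<^sub>\<theta>\<close> fixes \<open>\<theta>\<close> and exchanges the other
  two roots with determinant \<open>-1\<close>.  Hence \<open>1, N, N\<^sup>2, T\<^sub>u, T\<^sub>v, T\<^sub>w\<close> realise all six permutations, and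
  \<open>Aut F\<close> consists of those among them that are rational: \<open>N\<close> is rational iff the discriminant is a
  square, and \<open>T\<^sub>\<theta>\<close> is rational iff \<open>\<theta>\<close> is.  The four cases follow from the number of rational
  roots, since a rational \<open>N\<close> and one rational root make all roots rational.
\<close>

no_notation fps_nth (infixl "$" 75)

section \<open>Cyclic and dihedral groups\<close>

lemma (in group) int_pow_mod:
  assumes "x \<in> carrier G" "x [^] n = \<one>"
  shows "x [^] (i mod int n) = x [^] i"
proof -
  have "x [^] (int n * (i div int n)) = \<one>"
    using assms by (metis int_pow_pow int_pow_int int_pow_one)
  then have "x [^] (int n * (i div int n) + i mod int n) = x [^] (i mod int n)"
    using assms(1) by (simp only: int_pow_mult int_pow_closed l_one)
  then show ?thesis
    by (simp only: mult_div_mod_eq)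
qed

lemma (in group) generate_singleton_finite_order:
  assumes "x \<in> carrier G" "x [^] n = \<one>" "n > 0"
  shows "generate G {x} = (\<lambda>i::int. x [^] i) ` {0..<int n}"
proof -
  have "x [^] i \<in> (\<lambda>i::int. x [^] i) ` {0..<int n}" for i :: int
    by (rule image_eqI[of _ _ "i mod int n"]) (use assms in \<open>simp_all add: int_pow_mod\<close>)
  then show ?thesis
    unfolding generate_pow[OF assms(1)] by auto
qed

text \<open>The equation \<open>x [^] n = \<one>\<close> only bounds the order of \<open>x\<close>
  by a divisor of \<open>n\<close>; the bijection makes it exactly \<open>n\<close>. Transporting
  the structure of \<open>integer_mod_group n\<close> along \<open>i \<mapsto> x [^] i\<close> then
  gives the isomorphism.\<close>

lemma (in group) iso_integer_mod_group:
  assumes x: "x \<in> carrier G" "x [^] n = \<one>" and n: "n > 0"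
    and bij: "bij_betw (\<lambda>i::int. x [^] i) {0..<int n} H"
  shows "G\<lparr>carrier := H\<rparr> \<cong> integer_mod_group n"
proof -
  have "(\<lambda>i::int. x [^] i) \<in> iso (integer_mod_group n) (G\<lparr>carrier := H\<rparr>)"
  proof (rule isoI)
    show "(\<lambda>i::int. x [^] i) \<in> hom (integer_mod_group n) (G\<lparr>carrier := H\<rparr>)"
      using bij_betwE[OF bij] n x by (auto simp: hom_def carrier_integer_mod_group int_pow_mod int_pow_mult)
    show "bij_betw (\<lambda>i::int. x [^] i) (carrier (integer_mod_group n)) (carrier (G\<lparr>carrier := H\<rparr>))"
      using bij n by (simp add: carrier_integer_mod_group)
  qed
  then show ?thesis
    using group.iso_sym[OF group_integer_mod_group] is_iso_def by blast
qed

text \<open>The hypotheses on \<open>r\<close> and \<open>s\<close> are the dihedral relations,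
  which make \<open>(i, e) \<mapsto> r^i s^e\<close> multiplicative; the bijection excludes a proper
  quotient.\<close>

lemma (in group) iso_dihedral_group:
  assumes r: "r \<in> carrier G" "r [^] n = \<one>" and n: "n > 0"
    and s: "s \<in> carrier G" "s \<otimes> s = \<one>" and sr: "s \<otimes> r = inv r \<otimes> s"
    and bij: "bij_betw (\<lambda>(i::int, e). r [^] i \<otimes> (if e then s else \<one>)) ({0..<int n} \<times> UNIV) H"
  shows "G\<lparr>carrier := H\<rparr> \<cong> dihedral_group n"
proof -
  let ?f = "\<lambda>(i::int, e). r [^] i \<otimes> (if e then s else \<one>)"
  have "s \<otimes> r [^] k = inv (r [^] k) \<otimes> s" for k :: nat
  proof (induction k)
    case (Suc k)
    have "s \<otimes> r [^] Suc k = (s \<otimes> r [^] k) \<otimes> r"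
      using r s by (simp add: m_assoc)
    also have "\<dots> = inv (r [^] k) \<otimes> (s \<otimes> r)"
      unfolding Suc using r s by (simp add: m_assoc)
    also have "\<dots> = inv (r \<otimes> r [^] k) \<otimes> s"
      unfolding sr using r s by (simp add: m_assoc inv_mult_group)
    also have "r \<otimes> r [^] k = r [^] Suc k"
      using r by (metis nat_pow_Suc2)
    finally show ?case .
  qed (use s in simp)
  \<comment> \<open>Natural powers give this for non-negative \<open>j\<close> only, which is
    enough: in \<open>dihedral_group n\<close> the exponents lie in
    \<open>{0..<int n}\<close>.\<close>
  then have srk: "s \<otimes> r [^] j = r [^] (- j) \<otimes> s" if "j \<ge> 0" for j :: int
    using that r by (metis nonneg_int_cases int_pow_int int_pow_neg)
  have "?f (i, e) \<otimes> ?f (j, f) = ?f (((if e then i - j else i + j) mod int n, e \<noteq> f))"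
    if "j \<ge> 0" for i j e f
  proof (cases e)
    case True
    have "?f (i, e) \<otimes> ?f (j, f) = r [^] i \<otimes> (s \<otimes> r [^] j) \<otimes> (if f then s else \<one>)"
      using True r s by (simp add: m_assoc)
    also have "\<dots> = r [^] (i - j) \<otimes> (s \<otimes> (if f then s else \<one>))"
      using r s by (simp add: srk[OF that] m_assoc int_pow_diff int_pow_neg)
    finally show ?thesis
      using True r s by (simp add: int_pow_mod)
  next
    case False
    then show ?thesis
      using r s by (simp add: int_pow_mod int_pow_mult m_assoc)
  qed
  then have "?f \<in> iso (dihedral_group n) (G\<lparr>carrier := H\<rparr>)"
    using bij bij_betwE[OF bij] by (intro isoI) (auto simp: hom_def dihedral_group_def)
  then show ?thesis
    using group.iso_sym[OF group_dihedral_group[OF n]] is_iso_def by blast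
qed

section \<open>Binary cubic forms as polynomials\<close>

text \<open>In characteristic zero there are infinitely many constant polynomials, so
  \<open>P - Q\<close>, which vanishes at all of them, has infinitely many roots in an integral
  domain.\<close>

lemma poly_poly_eqI:
  fixes P Q :: "'a::{idom, ring_char_0} poly poly"
  assumes "\<And>r t. poly (poly P [:r:]) t = poly (poly Q [:r:]) t"
  shows "P = Q"
proof -
  have "poly P [:r:] = poly Q [:r:]" for r
    using assms poly_eq_poly_eq_iff by blast
  then have "range (\<lambda>r. [:r:]) \<subseteq> {p. poly (P - Q) p = 0}"
    by auto
  moreover have "infinite (range (\<lambda>r::'a. [:r:]))"
    by (simp add: finite_image_iff infinite_UNIV_char_0 inj_def)
  ultimately have "P - Q = 0"
    using poly_roots_finite finite_subset by blast
  then show ?thesis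
    by simp
qed

lemma form_Cubic:
  "form (Cubic b3 b2 b1 b0) =
    [:[:0, 0, 0, of_int b0:], [:0, 0, of_int b1:], [:0, of_int b2:], [:of_int b3:]:]"
  by (simp add: form_def poly_x_def poly_y_def of_int_poly power_numeral_reduce)

lemma linear_form_pCons: "linear_form a b = [:[:0, b:], [:a:]:]"
  by (simp add: linear_form_def poly_x_def poly_y_def)

lemma poly_form: "poly (poly (form F) [:r:]) t = eval_cubic F r t"
  by (cases F) (simp add: form_Cubic algebra_simps power_numeral_reduce)

lemma poly_linear_form: "poly (poly (linear_form a b) [:r:]) t = a * r + b * t"
  by (simp add: linear_form_pCons algebra_simps)

lemma poly_form_subst:
  "poly (poly (form_subst F T) [:r:]) t =
    eval_cubic F (T $ 1 $ 1 * r + T $ 1 $ 2 * t) (T $ 2 $ 1 * r + T $ 2 $ 2 * t)"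
  by (cases F) (simp add: form_subst_def poly_linear_form of_int_poly)

text \<open>
  Four rational points determine a binary cubic, so an identity between values at rational
  arguments extends to complex arguments.
\<close>
lemma eval_cubic_interpolate:
  fixes F :: int_cubic and t1 t2 t3 t4 :: "'a::comm_ring_1"
  defines "f \<equiv> \<lambda>x y. eval_cubic F (t1 * x + t2 * y) (t3 * x + t4 * y)"
  shows "2 * f x y = 2 * f 1 0 * (x ^ 3 - x * y\<^sup>2) + 2 * f 0 1 * (y ^ 3 - x\<^sup>2 * y)
    + f 1 1 * (x\<^sup>2 * y + x * y\<^sup>2) + f 1 (-1) * (x * y\<^sup>2 - x\<^sup>2 * y)"
  unfolding f_def by (cases F) (simp add: algebra_simps power_numeral_reduce)

definition preserves :: "int_cubic \<Rightarrow> complex^2^2 \<Rightarrow> bool" where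
  "preserves F T \<longleftrightarrow> (\<forall>x y. eval_cubic F (T $ 1 $ 1 * x + T $ 1 $ 2 * y) (T $ 2 $ 1 * x + T $ 2 $ 2 * y) = eval_cubic F x y)"

lemma of_rat_eval_cubic: "of_rat (eval_cubic F x y) = eval_cubic F (of_rat x) (of_rat y :: 'a::field_char_0)"
  by (cases F) (simp add: of_rat_add of_rat_mult of_rat_power)

lemma det_complex_mat: "det (complex_mat T) = of_rat (det T)"
  by (simp add: det_2 of_rat_diff of_rat_mult)

text \<open>Moves the question to complex matrices, where all three roots are available. The
  polynomial identity is equivalent to an identity of values at rational arguments, and
  interpolation carries this to complex arguments.\<close>

lemma Aut_iff: "T \<in> Aut F \<longleftrightarrow> det T \<noteq> 0 \<and> preserves F (complex_mat T)"
proof -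
  let ?g = "\<lambda>x y. eval_cubic F (T $ 1 $ 1 * x + T $ 1 $ 2 * y) (T $ 2 $ 1 * x + T $ 2 $ 2 * y)"
  let ?M = "complex_mat T"
  let ?f = "\<lambda>x y. eval_cubic F (?M $ 1 $ 1 * x + ?M $ 1 $ 2 * y) (?M $ 2 $ 1 * x + ?M $ 2 $ 2 * y)"
  have fg: "?f (of_rat x) (of_rat y) = of_rat (?g x y)" for x y
    by (simp add: of_rat_eval_cubic of_rat_add of_rat_mult)
  have "form_subst F T = form F \<longleftrightarrow> (\<forall>r t. ?g r t = eval_cubic F r t)"
    by (metis poly_form poly_form_subst poly_poly_eqI)
  also have "\<dots> \<longleftrightarrow> preserves F ?M"
  proof
    assume *: "\<forall>r t. ?g r t = eval_cubic F r t"
    have f: "?f (of_rat x) (of_rat y) = eval_cubic F (of_rat x) (of_rat y)" for x y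
      by (simp only: fg * of_rat_eval_cubic)
    have f4: "?f 1 0 = eval_cubic F 1 0" "?f 0 1 = eval_cubic F 0 1" "?f 1 1 = eval_cubic F 1 1"
      "?f 1 (-1) = eval_cubic F 1 (-1)"
      using f[of 1 0] f[of 0 1] f[of 1 1] f[of 1 "-1"] by (simp_all add: of_rat_minus)
    \<comment> \<open>Both sides are interpolated from the same four values; the right-hand side is
      the instance of the interpolation for the identity matrix.\<close>
    have "2 * ?f x y = 2 * eval_cubic F x y" for x y
      unfolding eval_cubic_interpolate[of F _ x _ y] f4
      using eval_cubic_interpolate[of F 1 x 0 y 0 1] by simp
    then show "preserves F ?M"
      by (simp add: preserves_def)
  next
    assume "preserves F ?M"
    then have "of_rat (?g x y) = (of_rat (eval_cubic F x y) :: complex)" for x y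
      unfolding fg[symmetric] by (simp add: of_rat_eval_cubic preserves_def)
    then show "\<forall>r t. ?g r t = eval_cubic F r t"
      by simp
  qed
  finally show ?thesis
    by (simp add: Aut_def GL2Q_def invertible_det_nz)
qed

text \<open>Synthetic division by \<open>x - r y\<close>: the second factor has the Horner
  coefficients, and the remainder is \<open>F(r, 1) y^3\<close>, which vanishes.\<close>

lemma form_factor:
  assumes "eval_cubic (Cubic b3 b2 b1 b0) r 1 = 0"
  shows "form (Cubic b3 b2 b1 b0) = linear_form 1 (- r) *
    [:[:0, 0, of_int b1 + r * (of_int b2 + r * of_int b3):], [:0, of_int b2 + r * of_int b3:], [:of_int b3:]:]"
  using assms by (simp add: form_Cubic linear_form_pCons) (simp add: algebra_simps power_numeral_reduce eq_neg_iff_add_eq_0)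

text \<open>The factors are arbitrary elements of \<open>Q[y][x]\<close>, not assumed homogeneous.
  Their degrees in \<open>x\<close> add up to 3, so one of them has degree at most 1. Its leading
  coefficient divides the unit \<open>b3\<close>, hence is a constant \<open>a\<close>: the factor
  is a unit, or it is \<open>a x + g(y)\<close> and yields the root
  \<open>- g(1) / a\<close>.\<close>

lemma irreducible_form_iff:
  assumes F: "F = Cubic b3 b2 b1 b0" and b3: "b3 \<noteq> 0"
  shows "irreducible (form F) \<longleftrightarrow> (\<forall>r::rat. eval_cubic F r 1 \<noteq> 0)"
proof safe
  fix r :: rat assume irr: "irreducible (form F)" and r: "eval_cubic F r 1 = 0"
  show False
    using irreducibleD[OF irr form_factor[OF r[unfolded F], folded F]] b3
    by (auto simp: linear_form_pCons is_unit_poly_iff)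
next
  assume no: "\<forall>r::rat. eval_cubic F r 1 \<noteq> 0"
  have deg: "degree (form F) = 3" and lead: "lead_coeff (form F) = [:of_int b3:]"
    using b3 by (simp_all add: F form_Cubic)
  have unit: "p dvd 1" if pq: "form F = p * q" and "degree p \<le> 1" for p q
  proof -
    have lc: "[:of_int b3:] = lead_coeff p * lead_coeff q"
      unfolding lead[symmetric] pq by (rule lead_coeff_mult)
    then have "lead_coeff p dvd [:of_int b3:]"
      by simp
    moreover have "[:of_int b3:] dvd (1 :: rat poly)"
      using b3 by (simp add: is_unit_poly_iff dvd_field_iff)
    ultimately have u: "lead_coeff p dvd 1"
      by (rule dvd_trans)
    then obtain a where a: "lead_coeff p = [:a:]" "a \<noteq> 0"
      by (auto simp: is_unit_poly_iff dvd_field_iff)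
    show ?thesis
    proof (cases "degree p = 0")
      case True
      then show ?thesis
        using u by (metis degree_eq_zeroE is_unit_poly_iff lead_coeff_pCons(2) lead_coeff_pCons(1))
    next
      case False
      with that(2) have "degree p = 1" by simp
      then obtain g where p: "p = [:g, [:a:]:]"
        using a by (metis degree1_coeffs coeff_pCons_0 coeff_pCons_Suc One_nat_def)
      define r where "r = - poly g 1 / a"
      have "eval_cubic F r 1 = poly (poly p [:r:]) 1 * poly (poly q [:r:]) 1"
        by (simp flip: poly_form add: pq)
      also have "poly (poly p [:r:]) 1 = 0"
        using a by (simp add: p r_def)
      finally show ?thesis
        using no by simp
    qed
  qed
  show "irreducible (form F)"
  proof (rule irreducibleI)
    show "form F \<noteq> 0" "\<not> form F dvd 1"
      using deg by (auto simp: is_unit_poly_iff)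
    fix p q assume pq: "form F = p * q"
    then have "degree p + degree q = 3"
      using deg by (metis degree_mult_eq mult_zero_left mult_zero_right degree_0 zero_neq_numeral)
    then have "degree p \<le> 1 \<or> degree q \<le> 1"
      by linarith
    then show "p dvd 1 \<or> q dvd 1"
      using unit[of p q] unit[of q p] pq by (auto simp: mult.commute)
  qed
qed

lemma rational_linear_factor_iff:
  assumes F: "F = Cubic b3 b2 b1 b0" and b3: "b3 \<noteq> 0"
  shows "rational_linear_factor F a b \<longleftrightarrow> a \<noteq> 0 \<and> eval_cubic F (- b / a) 1 = 0"
proof
  assume "rational_linear_factor F a b"
  then obtain k where ab: "(a, b) \<noteq> (0, 0)" and k: "form F = linear_form a b * k"
    by (auto simp: rational_linear_factor_def)
  have e: "eval_cubic F r t = (a * r + b * t) * poly (poly k [:r:]) t" for r t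
    by (simp flip: poly_form add: k poly_linear_form)
  \<comment> \<open>At \<open>(1, 0)\<close> the form takes the value \<open>b3\<close>, whereas a
    multiple of \<open>b y\<close> vanishes there.\<close>
  have "a \<noteq> 0"
    using e[of 1 0] b3 by (auto simp: F)
  then show "a \<noteq> 0 \<and> eval_cubic F (- b / a) 1 = 0"
    by (simp add: e)
next
  assume a: "a \<noteq> 0 \<and> eval_cubic F (- b / a) 1 = 0"
  have "linear_form a b = [:[:a:]:] * linear_form 1 (- (- b / a))"
    using a by (simp add: linear_form_pCons)
  moreover have "[:[:a:]:] dvd 1"
    using a by (simp add: is_unit_poly_iff dvd_field_iff)
  moreover have "linear_form 1 (- (- b / a)) dvd form F"
    using form_factor[of b3 b2 b1 b0 "- b / a"] a unfolding F by (metis dvd_triv_left)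
  ultimately have "linear_form a b dvd form F"
    by (metis mult_unit_dvd_iff')
  then show "rational_linear_factor F a b"
    using a by (simp add: rational_linear_factor_def)
qed

lemma sole_rational_linear_factor_iff:
  assumes F: "F = Cubic b3 b2 b1 b0" and b3: "b3 \<noteq> 0"
  shows "sole_rational_linear_factor F \<theta> \<longleftrightarrow> (\<exists>r. \<theta> = of_rat r \<and> {r. eval_cubic F r 1 = 0} = {r})"
proof
  assume "sole_rational_linear_factor F \<theta>"
  then obtain a b where ab: "a \<noteq> 0" "eval_cubic F (- b / a) 1 = 0" and th: "of_rat a * \<theta> + of_rat b = 0"
    and u: "\<And>c d. c \<noteq> 0 \<and> eval_cubic F (- d / c) 1 = 0 \<Longrightarrow> \<exists>k. c = k * a \<and> d = k * b"
    unfolding sole_rational_linear_factor_def rational_linear_factor_iff[OF assms] by blast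
  have "\<theta> = of_rat (- b / a)"
    using ab(1) th by (simp add: of_rat_divide of_rat_minus field_simps add_eq_0_iff)
  moreover have "r = - b / a" if r: "eval_cubic F r 1 = 0" for r
  proof -
    obtain k where k: "1 = k * a" "- r = k * b"
      using u[of 1 "- r"] r by auto
    then have k': "k = 1 / a"
      using ab(1) by (simp add: nonzero_eq_divide_eq)
    have "r = - (- r)"
      by simp
    also have "\<dots> = - b / a"
      unfolding k(2) k' by simp
    finally show ?thesis .
  qed
  ultimately show "\<exists>r. \<theta> = of_rat r \<and> {r. eval_cubic F r 1 = 0} = {r}"
    using ab(2) by blast
next
  assume "\<exists>r. \<theta> = of_rat r \<and> {r. eval_cubic F r 1 = 0} = {r}"
  then obtain r where r: "\<theta> = of_rat r" "eval_cubic F r 1 = 0" "\<And>r'. eval_cubic F r' 1 = 0 \<Longrightarrow> r' = r"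
    by blast
  have "c = c * 1 \<and> d = c * - r" if "c \<noteq> 0 \<and> eval_cubic F (- d / c) 1 = 0" for c d
  proof -
    have "r = - d / c"
      using r(3) that by metis
    then show ?thesis
      using that by simp
  qed
  moreover have "(1::rat) \<noteq> 0 \<and> eval_cubic F (- (- r) / 1) 1 = 0"
    using r(2) by simp
  moreover have "of_rat 1 * \<theta> + of_rat (- r) = 0"
    by (simp add: r(1) of_rat_minus)
  ultimately show "sole_rational_linear_factor F \<theta>"
    unfolding sole_rational_linear_factor_def rational_linear_factor_iff[OF assms] by blast
qed

lemma splits_over_rat_imp_rational_root:
  assumes F: "F = Cubic b3 b2 b1 b0" and b3: "b3 \<noteq> 0" and "splits_over_rat F"
    and root: "eval_cubic F \<theta> 1 = (0::complex)"
  shows "\<theta> \<in> \<rat>"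
proof -
  obtain a1 c1 a2 c2 a3 c3 where "form F = linear_form a1 c1 * linear_form a2 c2 * linear_form a3 c3"
    using assms(3) splits_over_rat_def by blast
  then have c: "of_int b3 = a1 * a2 * a3" "of_int b2 = a1 * a2 * c3 + a1 * c2 * a3 + c1 * a2 * a3"
      "of_int b1 = a1 * c2 * c3 + c1 * a2 * c3 + c1 * c2 * a3" "of_int b0 = c1 * c2 * c3"
    by (simp_all add: F form_Cubic linear_form_pCons algebra_simps)
  \<comment> \<open>The coefficient identities \<open>c\<close> hold in the rationals; writing
    integers as images of rationals lets them be substituted inside a complex expression.\<close>
  have "of_int n = (of_rat (of_int n) :: complex)" for n
    by simp
  note c' = this[of b3, unfolded c] this[of b2, unfolded c] this[of b1, unfolded c] this[of b0, unfolded c]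
  have "eval_cubic F \<theta> 1 = (of_rat a1 * \<theta> + of_rat c1) * (of_rat a2 * \<theta> + of_rat c2) * (of_rat a3 * \<theta> + of_rat c3)"
    unfolding F eval_cubic.simps c' by (simp add: of_rat_add of_rat_mult algebra_simps power_numeral_reduce)
  moreover have "\<theta> \<in> \<rat>" if "of_rat a * \<theta> + of_rat c = 0" "a \<noteq> 0" for a c
  proof -
    have "\<theta> = of_rat (- c / a)"
      using that by (simp add: of_rat_divide of_rat_minus field_simps add_eq_0_iff)
    then show ?thesis
      by simp
  qed
  moreover have "a1 \<noteq> 0" "a2 \<noteq> 0" "a3 \<noteq> 0"
    using c(1) b3 by auto
  ultimately show ?thesis
    using root by auto
qed

section \<open>Matrices acting on linear forms\<close>

lemma matrix2_eq_iff:
  "A = B \<longleftrightarrow> A $ 1 $ 1 = B $ 1 $ 1 \<and> A $ 1 $ 2 = B $ 1 $ 2 \<and> A $ 2 $ 1 = B $ 2 $ 1 \<and> A $ 2 $ 2 = B $ 2 $ 2"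
  for A B :: "'a^2^2"
  by (auto simp: vec_eq_iff forall_2)

lemma matrix_mult2:
  fixes A B :: "'a::semiring_1^2^2"
  shows "(A ** B) $ i $ j = A $ i $ 1 * B $ 1 $ j + A $ i $ 2 * B $ 2 $ j"
  by (simp add: matrix_matrix_mult_def sum_2)

lemma mat2_nth [simp]:
  "(mat c :: 'a::zero^2^2) $ 1 $ 1 = c" "(mat c :: 'a^2^2) $ 1 $ 2 = 0"
  "(mat c :: 'a^2^2) $ 2 $ 1 = 0" "(mat c :: 'a^2^2) $ 2 $ 2 = c"
  by (simp_all add: mat_def)

text \<open>
  With \<open>L\<^sub>\<theta> = x - \<theta> y\<close>, this says \<open>L\<^sub>\<theta> \<circ> T = \<mu> L\<^sub>\<eta>\<close>: for \<open>\<mu> \<noteq> 0\<close>, the Moebius map of \<open>T\<close> sends \<open>\<eta>\<close> to \<open>\<theta>\<close>,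
  not \<open>\<theta>\<close> to \<open>\<eta>\<close>.
\<close>
definition pulls :: "complex^2^2 \<Rightarrow> complex \<Rightarrow> complex \<Rightarrow> complex \<Rightarrow> bool" where
  "pulls T \<theta> \<eta> \<mu> \<longleftrightarrow> T $ 1 $ 1 - \<theta> * T $ 2 $ 1 = \<mu> \<and> T $ 1 $ 2 - \<theta> * T $ 2 $ 2 = - \<mu> * \<eta>"

lemma pulls_apply:
  assumes "pulls T \<theta> \<eta> \<mu>"
  shows "(T $ 1 $ 1 * x + T $ 1 $ 2 * y) - \<theta> * (T $ 2 $ 1 * x + T $ 2 $ 2 * y) = \<mu> * (x - \<eta> * y)"
proof -
  have "(T $ 1 $ 1 * x + T $ 1 $ 2 * y) - \<theta> * (T $ 2 $ 1 * x + T $ 2 $ 2 * y)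
    = (T $ 1 $ 1 - \<theta> * T $ 2 $ 1) * x + (T $ 1 $ 2 - \<theta> * T $ 2 $ 2) * y"
    by (simp add: algebra_simps)
  also have "\<dots> = \<mu> * x + (- \<mu> * \<eta>) * y"
    using assms by (simp only: pulls_def)
  finally show ?thesis
    by (simp add: algebra_simps)
qed

lemma pulls_mat_1: "pulls (mat 1) \<theta> \<theta> 1"
  by (simp add: pulls_def)

text \<open>Substitution composes as \<open>(L\<^sub>\<theta> \<circ> S) \<circ> T\<close>, so a
  product acts on the roots from left to right, in the order in which it is written.\<close>

lemma pulls_mult:
  assumes "pulls S \<theta> \<eta> \<mu>" and T: "pulls T \<eta> \<zeta> \<nu>"
  shows "pulls (S ** T) \<theta> \<zeta> (\<mu> * \<nu>)"
proof -
  have *: "(S ** T) $ 1 $ j - \<theta> * (S ** T) $ 2 $ j = \<mu> * (T $ 1 $ j - \<eta> * T $ 2 $ j)" for j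
    using pulls_apply[OF assms(1), of "T $ 1 $ j" "T $ 2 $ j"] by (simp add: matrix_mult2)
  show ?thesis
    using T unfolding pulls_def * by (simp only: pulls_def) simp
qed

text \<open>The matrix with rows \<open>(1, - \<theta>)\<close> and \<open>(1, - \<theta>')\<close>
  has determinant \<open>\<theta> - \<theta>'\<close>. Multiplying it by \<open>T\<close> on the
  right gives the corresponding matrix for \<open>\<eta>, \<eta>'\<close> with rows scaled by
  \<open>\<mu>, \<mu>'\<close>; the claim compares determinants.\<close>

lemma pulls_det:
  assumes "pulls T \<theta> \<eta> \<mu>" "pulls T \<theta>' \<eta>' \<mu>'"
  shows "(\<theta> - \<theta>') * det T = \<mu> * \<mu>' * (\<eta> - \<eta>')"
proof -
  have "(\<theta> - \<theta>') * det T =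
    (T $ 1 $ 2 - \<theta>' * T $ 2 $ 2) * (T $ 1 $ 1 - \<theta> * T $ 2 $ 1) - (T $ 1 $ 1 - \<theta>' * T $ 2 $ 1) * (T $ 1 $ 2 - \<theta> * T $ 2 $ 2)"
    by (simp add: det_2 algebra_simps)
  also have "\<dots> = (- \<mu>' * \<eta>') * \<mu> - \<mu>' * (- \<mu> * \<eta>)"
    using assms by (simp only: pulls_def)
  finally show ?thesis
    by (simp add: algebra_simps)
qed

text \<open>For \<open>\<theta> \<noteq> \<theta>'\<close> the forms \<open>L\<^sub>\<theta>\<close>
  and \<open>L\<^sub>\<theta>'\<close> are a basis of the linear forms, and a matrix is determined
  by its action on a basis.\<close>

lemma pulls_unique:
  assumes "pulls S \<theta> \<eta> \<mu>" "pulls S \<theta>' \<eta>' \<mu>'" "pulls T \<theta> \<eta> \<mu>" "pulls T \<theta>' \<eta>' \<mu>'" "\<theta> \<noteq> \<theta>'"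
  shows "S = T"
proof -
  have *: "a = c \<and> b = d" if "a - \<theta> * b = c - \<theta> * d" "a - \<theta>' * b = c - \<theta>' * d" for a b c d :: complex
  proof -
    have "(\<theta> - \<theta>') * (b - d) = (a - \<theta>' * b) - (a - \<theta> * b) - ((c - \<theta>' * d) - (c - \<theta> * d))"
      by (simp add: algebra_simps)
    then have "(\<theta> - \<theta>') * (b - d) = 0"
      by (simp add: that)
    then have "b = d"
      using assms(5) by simp
    then show ?thesis
      using that by simp
  qed
  show ?thesis
    using assms(1-4) *[of "S $ 1 $ 1" "S $ 2 $ 1" "T $ 1 $ 1" "T $ 2 $ 1"]
      *[of "S $ 1 $ 2" "S $ 2 $ 2" "T $ 1 $ 2" "T $ 2 $ 2"]
    by (simp add: pulls_def matrix2_eq_iff)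
qed

text \<open>
  The identity \<open>(v - w) L\<^sub>u + (w - u) L\<^sub>v + (u - v) L\<^sub>w = 0\<close> between the linear forms
  \<open>L\<^sub>\<theta> = x - \<theta> y\<close> fixes the multipliers up to a common factor \<open>c\<close>.  The remaining hypotheses
  give \<open>det T = c\<^sup>2 e\<close> and \<open>c\<^sup>3 e = 1\<close>, so that \<open>c = e\<close> because \<open>det T\<close> is real.
\<close>
lemma pulls_multiplier:
  assumes p: "pulls T u \<eta>1 \<mu>1" "pulls T v \<eta>2 \<mu>2" "pulls T w \<eta>3 \<mu>3"
    and d: "u \<noteq> v" "v \<noteq> w" "w \<noteq> u" and d': "\<eta>1 \<noteq> \<eta>2" "\<eta>2 \<noteq> \<eta>3" "\<eta>3 \<noteq> \<eta>1"
    and prod: "\<mu>1 * \<mu>2 * \<mu>3 = 1" and det: "det T \<in> \<real>"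
    and e: "(\<eta>1 - \<eta>2) * (\<eta>2 - \<eta>3) * (\<eta>3 - \<eta>1) = e * ((u - v) * (v - w) * (w - u))" "e = 1 \<or> e = -1"
  shows "\<mu>1 = e * (\<eta>2 - \<eta>3) / (v - w)" "\<mu>2 = e * (\<eta>3 - \<eta>1) / (w - u)"
proof -
  define c where "c = (v - w) * \<mu>1 / (\<eta>2 - \<eta>3)"
  have mu1: "(v - w) * \<mu>1 = c * (\<eta>2 - \<eta>3)"
    using d' by (simp add: c_def)
  \<comment> \<open>\<open>s1\<close> and \<open>s2\<close> are, up to sign, the coefficients of
    \<open>x\<close> and \<open>y\<close> in the linear relation after substituting
    \<open>T\<close>.\<close>
  have s1: "(v - w) * \<mu>1 + (w - u) * \<mu>2 + (u - v) * \<mu>3 = 0"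
    by (simp only: p[unfolded pulls_def, THEN conjunct1, symmetric]) (simp add: algebra_simps)
  have "(v - w) * (- \<mu>1 * \<eta>1) + (w - u) * (- \<mu>2 * \<eta>2) + (u - v) * (- \<mu>3 * \<eta>3) = 0"
    by (simp only: p[unfolded pulls_def, THEN conjunct2, symmetric]) (simp add: algebra_simps)
  then have s2: "(v - w) * \<mu>1 * \<eta>1 + (w - u) * \<mu>2 * \<eta>2 + (u - v) * \<mu>3 * \<eta>3 = 0"
    by (simp add: algebra_simps)
  \<comment> \<open>Subtracting \<open>\<eta>3\<close> times the first relation from the second
    eliminates \<open>\<mu>3\<close>.\<close>
  have "(v - w) * \<mu>1 * (\<eta>1 - \<eta>3) + (w - u) * \<mu>2 * (\<eta>2 - \<eta>3) =
    ((v - w) * \<mu>1 * \<eta>1 + (w - u) * \<mu>2 * \<eta>2 + (u - v) * \<mu>3 * \<eta>3) - \<eta>3 * ((v - w) * \<mu>1 + (w - u) * \<mu>2 + (u - v) * \<mu>3)"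
    by (simp add: algebra_simps)
  then have "(\<eta>2 - \<eta>3) * ((w - u) * \<mu>2 - c * (\<eta>3 - \<eta>1)) = 0"
    unfolding s1 s2 unfolding mu1 by (simp add: algebra_simps)
  then have mu2: "(w - u) * \<mu>2 = c * (\<eta>3 - \<eta>1)"
    using d' by simp
  have mu3: "(u - v) * \<mu>3 = c * (\<eta>1 - \<eta>2)"
    using s1 unfolding mu1 mu2 by (simp add: algebra_simps add_eq_0_iff)
  define V where "V = (u - v) * (v - w) * (w - u)"
  have V: "V \<noteq> 0"
    using d by (simp add: V_def)
  have "(u - v) * det T = \<mu>1 * \<mu>2 * (\<eta>1 - \<eta>2)"
    by (rule pulls_det) (use p in auto)
  then have "V * det T = ((v - w) * \<mu>1) * ((w - u) * \<mu>2) * (\<eta>1 - \<eta>2)"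
    by (simp add: V_def)
  also have "\<dots> = c\<^sup>2 * ((\<eta>1 - \<eta>2) * (\<eta>2 - \<eta>3) * (\<eta>3 - \<eta>1))"
    unfolding mu1 mu2 by (simp add: power2_eq_square)
  also have "\<dots> = V * (c\<^sup>2 * e)"
    unfolding e V_def by simp
  finally have "det T = c\<^sup>2 * e"
    using V by simp
  then have "c\<^sup>2 = e * det T"
    using e(2) by auto
  then have cR: "c\<^sup>2 \<in> \<real>"
    using e(2) det by auto
  have "V = V * (\<mu>1 * \<mu>2 * \<mu>3)"
    using prod by simp
  also have "\<dots> = ((v - w) * \<mu>1) * ((w - u) * \<mu>2) * ((u - v) * \<mu>3)"
    by (simp add: V_def)
  also have "\<dots> = c ^ 3 * ((\<eta>1 - \<eta>2) * (\<eta>2 - \<eta>3) * (\<eta>3 - \<eta>1))"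
    unfolding mu1 mu2 mu3 by (simp add: power3_eq_cube)
  also have "\<dots> = V * (c ^ 3 * e)"
    unfolding e V_def by simp
  finally have "c ^ 3 * e = 1"
    using V by simp
  moreover have "e * e = 1"
    using e(2) by auto
  ultimately have c3: "c ^ 3 = e"
    by (metis mult.assoc mult.commute mult_1)
  \<comment> \<open>Since \<open>c\<^sup>2\<close> is real with cube \<open>e\<^sup>2 = 1\<close>,
    it equals 1, and then \<open>c = c ^ 3 = e\<close>. This is where non-real cube roots of unity
    are excluded.\<close>
  have "(c\<^sup>2) ^ 3 = (c ^ 3)\<^sup>2"
    by (simp flip: power_mult)
  then have "(c\<^sup>2) ^ 3 = 1"
    using c3 e(2) by auto
  moreover obtain r where r: "c\<^sup>2 = of_real r"
    using cR Reals_cases by blast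
  ultimately have "r ^ 3 = 1"
    by (simp flip: of_real_power)
  then have "r = 1"
    using odd_real_root_power_cancel[of 3 r] by simp
  with r c3 have "c = e"
    by (simp add: power3_eq_cube power2_eq_square)
  then show "\<mu>1 = e * (\<eta>2 - \<eta>3) / (v - w)" "\<mu>2 = e * (\<eta>3 - \<eta>1) / (w - u)"
    using mu1 mu2 d by (simp_all add: eq_divide_eq mult.commute)
qed


text \<open>Stated ahead of the locale of distinct roots, because distinctness is itself derived
  from this formula in \<open>oriented_cubic_exists\<close>.\<close>

lemma cubic_disc_factored:
  fixes u v w :: complex
  assumes "of_int b2 = - of_int b3 * (u + v + w)"
    and "of_int b1 = of_int b3 * (u * v + v * w + w * u)"
    and "of_int b0 = - of_int b3 * (u * v * w)"
  shows "of_int (cubic_disc (Cubic b3 b2 b1 b0)) = (of_int b3 ^ 2 * ((u - v) * (v - w) * (w - u)))\<^sup>2"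
  by (simp add: assms) (simp add: algebra_simps power_numeral_reduce)

section \<open>The covariants in terms of the roots\<close>

text \<open>The Hessian and the Julia covariant at \<open>u\<close> are symmetric in the other two
  roots, so they can be written in \<open>u\<close> and the sum \<open>p\<close> and product
  \<open>q\<close> of those two. This keeps the polynomial identities small.\<close>

lemma covariants_factored:
  fixes k u p q :: complex
  assumes b2: "b2 = - k * (u + p)"
    and b1: "b1 = k * (u * p + q)"
    and b0: "b0 = - k * (u * q)"
  shows "b2\<^sup>2 - 3 * k * b1 = k\<^sup>2 * (u\<^sup>2 - u * p + p\<^sup>2 - 3 * q)"
    "b2 * b1 - 9 * k * b0 = k\<^sup>2 * (8 * u * q - u\<^sup>2 * p - u * p\<^sup>2 - p * q)"
    "b1\<^sup>2 - 3 * b2 * b0 = k\<^sup>2 * (u\<^sup>2 * p\<^sup>2 - u * p * q + q\<^sup>2 - 3 * u\<^sup>2 * q)"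
    "9 * k\<^sup>2 * u\<^sup>2 + 6 * k * b2 * u + 6 * k * b1 - b2\<^sup>2 = k\<^sup>2 * (2 * u\<^sup>2 - 2 * u * p + 6 * q - p\<^sup>2)"
    "6 * k * b2 * u\<^sup>2 + 6 * (b2\<^sup>2 - k * b1) * u + 2 * b2 * b1 =
       k\<^sup>2 * (4 * u * p\<^sup>2 - 2 * u\<^sup>2 * p - 8 * u * q - 2 * p * q)"
    "3 * k * b1 * u\<^sup>2 + 3 * (b2 * b1 - 3 * k * b0) * u + 2 * b1\<^sup>2 - 3 * b2 * b0 =
       k\<^sup>2 * (6 * u\<^sup>2 * q - u\<^sup>2 * p\<^sup>2 - 2 * u * p * q + 2 * q\<^sup>2)"
  unfolding b2 b1 b0 by (simp_all add: algebra_simps power_numeral_reduce)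

text \<open>These are the entries of the product of the two matrices \<open>mat_M\<close>, up to a
  power of the leading coefficient. Their common factor is
  \<open>6 (u - v) (u - w) (v - w)^2\<close>, which cancels against
  \<open>6 * cubic_disc F\<close>.\<close>

lemma julia_hessian_products:
  fixes u p q :: complex
  defines "A \<equiv> u\<^sup>2 - u * p + p\<^sup>2 - 3 * q"
    and "B \<equiv> 8 * u * q - u\<^sup>2 * p - u * p\<^sup>2 - p * q"
    and "C \<equiv> u\<^sup>2 * p\<^sup>2 - u * p * q + q\<^sup>2 - 3 * u\<^sup>2 * q"
    and "h2 \<equiv> 2 * u\<^sup>2 - 2 * u * p + 6 * q - p\<^sup>2"
    and "h1 \<equiv> 4 * u * p\<^sup>2 - 2 * u\<^sup>2 * p - 8 * u * q - 2 * p * q"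
    and "h0 \<equiv> 6 * u\<^sup>2 * q - u\<^sup>2 * p\<^sup>2 - 2 * u * p * q + 2 * q\<^sup>2"
  shows "h1 * B - 4 * h0 * A = 6 * (u\<^sup>2 - u * p + q) * (p\<^sup>2 - 4 * q) * (u\<^sup>2 - q)"
    "2 * h1 * C - 2 * h0 * B = 6 * (u\<^sup>2 - u * p + q) * (p\<^sup>2 - 4 * q) * (2 * u * q - u\<^sup>2 * p)"
    "2 * h1 * A - 2 * h2 * B = 6 * (u\<^sup>2 - u * p + q) * (p\<^sup>2 - 4 * q) * (2 * u - p)"
    "h1 * B - 4 * h2 * C = 6 * (u\<^sup>2 - u * p + q) * (p\<^sup>2 - 4 * q) * (q - u\<^sup>2)"
  unfolding A_def B_def C_def h2_def h1_def h0_def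
  by (simp_all add: algebra_simps power_numeral_reduce)

locale factored_cubic =
  fixes b3 b2 b1 b0 :: int and u v w :: complex
  assumes b3: "b3 \<noteq> 0"
    and b2: "of_int b2 = - of_int b3 * (u + v + w)"
    and b1: "of_int b1 = of_int b3 * (u * v + v * w + w * u)"
    and b0: "of_int b0 = - of_int b3 * (u * v * w)"
    and distinct: "u \<noteq> v" "v \<noteq> w" "w \<noteq> u"
begin

abbreviation "F \<equiv> Cubic b3 b2 b1 b0"

lemma eval_F: "eval_cubic F x y = of_int b3 * (x - u * y) * (x - v * y) * (x - w * y)"
  by (simp add: b2 b1 b0 power2_eq_square power3_eq_cube) (simp add: algebra_simps)

lemma disc_F: "of_int (cubic_disc F) = (of_int b3 ^ 2 * ((u - v) * (v - w) * (w - u)))\<^sup>2"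
  by (rule cubic_disc_factored[OF b2 b1 b0])

lemma quadratic_disc_hessian: "quadratic_disc (hessian F) = - 3 * of_int (cubic_disc F)"
  by (simp add: algebra_simps power_numeral_reduce)

text \<open>The labelling of the roots is part of the locale; relabelling carries facts proved for
  \<open>u\<close> over to \<open>v\<close> and \<open>w\<close>.\<close>

lemma rotate: "factored_cubic b3 b2 b1 b0 v w u"
  using b3 b2 b1 b0 distinct by unfold_locales (auto simp: algebra_simps)

lemma swap: "factored_cubic b3 b2 b1 b0 u w v"
  using b3 b2 b1 b0 distinct by unfold_locales (auto simp: algebra_simps)

lemma mat_T_F: "mat_T F u = vector
  [vector [- (u\<^sup>2 - v * w) / ((u - v) * (u - w)), - (2 * u * v * w - u\<^sup>2 * (v + w)) / ((u - v) * (u - w))],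
   vector [- (2 * u - v - w) / ((u - v) * (u - w)), (u\<^sup>2 - v * w) / ((u - v) * (u - w))]]"
proof -
  define k :: complex where "k = of_int b3"
  define p q where pq: "p = v + w" "q = v * w"
  define E where "E = 6 * (u\<^sup>2 - u * p + q) * (p\<^sup>2 - 4 * q)"
  have b: "of_int b2 = - k * (u + p)" "of_int b1 = k * (u * p + q)" "of_int b0 = - k * (u * q)"
    by (simp_all add: b2 b1 b0 pq k_def algebra_simps)
  have d: "k \<noteq> 0" "u - v \<noteq> 0" "u - w \<noteq> 0" "v - w \<noteq> 0"
    using b3 distinct by (auto simp: k_def)
  have uvw: "u\<^sup>2 - u * p + q = (u - v) * (u - w)" "p\<^sup>2 - 4 * q = (v - w)\<^sup>2"
    by (simp_all add: pq algebra_simps power2_eq_square)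
  have disc: "6 * of_int (cubic_disc F) = (k ^ 4 * E) * ((u - v) * (u - w))"
    unfolding disc_F E_def uvw k_def[symmetric] by (simp add: power_numeral_reduce algebra_simps)
  have E0: "k ^ 4 * E \<noteq> 0"
    unfolding E_def uvw using d by simp
  \<comment> \<open>Only the common factor \<open>a\<close> is cancelled; for \<open>D = 0\<close>
    both sides are 0 by the convention for division by zero.\<close>
  have "- 1 / (a * D) * (a * x) = - x / D" if "a \<noteq> 0" for a D x :: complex
    using that by (cases "D = 0") (simp_all add: field_simps)
  note div = this[OF E0, of "(u - v) * (u - w)", folded disc]
  note J = covariants_factored[OF b]
  have hess: "hessian F = Quadratic (k\<^sup>2 * (u\<^sup>2 - u * p + p\<^sup>2 - 3 * q))
      (k\<^sup>2 * (8 * u * q - u\<^sup>2 * p - u * p\<^sup>2 - p * q)) (k\<^sup>2 * (u\<^sup>2 * p\<^sup>2 - u * p * q + q\<^sup>2 - 3 * u\<^sup>2 * q))"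
    unfolding J(1-3)[symmetric] by (simp add: k_def)
  have jul: "julia F u = Quadratic (k\<^sup>2 * (2 * u\<^sup>2 - 2 * u * p + 6 * q - p\<^sup>2))
      (k\<^sup>2 * (4 * u * p\<^sup>2 - 2 * u\<^sup>2 * p - 8 * u * q - 2 * p * q))
      (k\<^sup>2 * (6 * u\<^sup>2 * q - u\<^sup>2 * p\<^sup>2 - 2 * u * p * q + 2 * q\<^sup>2))"
    unfolding J(4-6)[symmetric] by (simp add: k_def Let_def)
  have k4: "k\<^sup>2 * x * (k\<^sup>2 * y) + 2 * (k\<^sup>2 * z) * (- 2 * (k\<^sup>2 * t)) = k ^ 4 * (x * y - 4 * z * t)"
    "k\<^sup>2 * x * (2 * (k\<^sup>2 * y)) + 2 * (k\<^sup>2 * z) * - (k\<^sup>2 * t) = k ^ 4 * (2 * x * y - 2 * z * t)"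
    "- 2 * (k\<^sup>2 * z) * (k\<^sup>2 * t) + - (k\<^sup>2 * x) * (- 2 * (k\<^sup>2 * y)) = k ^ 4 * (2 * x * y - 2 * z * t)"
    "- 2 * (k\<^sup>2 * z) * (2 * (k\<^sup>2 * t)) + - (k\<^sup>2 * x) * - (k\<^sup>2 * y) = k ^ 4 * (x * y - 4 * z * t)"
    for x y z t
    by (simp_all add: algebra_simps power_numeral_reduce)
  have M: "mat_M (julia F u) ** mat_M (hessian F) = vector
    [vector [(k ^ 4 * E) * (u\<^sup>2 - q), (k ^ 4 * E) * (2 * u * q - u\<^sup>2 * p)],
     vector [(k ^ 4 * E) * (2 * u - p), (k ^ 4 * E) * (q - u\<^sup>2)]]"
    unfolding matrix2_eq_iff matrix_mult2 hess jul mat_M.simps vector_2 k4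
    unfolding julia_hessian_products E_def by (simp only: mult.assoc simp_thms)
  show ?thesis
    unfolding matrix2_eq_iff mat_T_def M nth_map_matrix vector_2 div
    by (simp add: pq algebra_simps)
qed

text \<open>The assumption fixes the sign of the square root. The sums \<open>X\<close> and
  \<open>Y\<close> are exchanged by odd permutations of the roots, with \<open>d = Y - X\<close> and
  \<open>B = 6 u v w - X - Y\<close>; hence each of \<open>B + d\<close> and \<open>B - d\<close>
  retains only one of them.\<close>

lemma mat_N_hessian:
  assumes "csqrt (- 3 * quadratic_disc (hessian F)) = 3 * of_int b3 ^ 2 * ((u - v) * (v - w) * (w - u))"
  defines "X \<equiv> u\<^sup>2 * v + v\<^sup>2 * w + w\<^sup>2 * u" and "Y \<equiv> u * v\<^sup>2 + v * w\<^sup>2 + w * u\<^sup>2"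
  defines "d \<equiv> (u - v) * (v - w) * (w - u)"
  shows "mat_N (hessian F) = vector
    [vector [(X - 3 * u * v * w) / d, - ((u * v + v * w + w * u)\<^sup>2 - 3 * (u + v + w) * (u * v * w)) / d],
     vector [((u + v + w)\<^sup>2 - 3 * (u * v + v * w + w * u)) / d, (3 * u * v * w - Y) / d]]"
proof -
  define k :: complex where "k = of_int b3"
  have d: "d \<noteq> 0" "k \<noteq> 0"
    using b3 distinct by (auto simp: d_def k_def)
  define A B C where "A = (u + v + w)\<^sup>2 - 3 * (u * v + v * w + w * u)"
    and "B = 6 * u * v * w - X - Y"
    and "C = (u * v + v * w + w * u)\<^sup>2 - 3 * (u + v + w) * (u * v * w)"
  have hess: "hessian F = Quadratic (k\<^sup>2 * A) (k\<^sup>2 * B) (k\<^sup>2 * C)"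
    by (simp add: A_def B_def C_def X_def Y_def b2 b1 b0 flip: k_def)
      (simp add: algebra_simps power_numeral_reduce)
  have disc: "quadratic_disc (hessian F) = - 3 * (k\<^sup>2 * d)\<^sup>2"
    unfolding quadratic_disc_hessian disc_F by (simp add: d_def k_def)
  have XY: "d = Y - X"
    by (simp add: d_def X_def Y_def algebra_simps power_numeral_reduce)
  have cancel: "1 / (2 * (- 3 * (k\<^sup>2 * d)\<^sup>2)) * (k\<^sup>2 * x * (3 * k\<^sup>2 * d) - - 3 * (k\<^sup>2 * d)\<^sup>2) = - (x + d) / (2 * d)"
    "1 / (2 * (- 3 * (k\<^sup>2 * d)\<^sup>2)) * (- (k\<^sup>2 * x) * (3 * k\<^sup>2 * d) - - 3 * (k\<^sup>2 * d)\<^sup>2) = (x - d) / (2 * d)"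
    "1 / (2 * (- 3 * (k\<^sup>2 * d)\<^sup>2)) * (2 * (k\<^sup>2 * x) * (3 * k\<^sup>2 * d)) = - x / d"
    "1 / (2 * (- 3 * (k\<^sup>2 * d)\<^sup>2)) * (- 2 * (k\<^sup>2 * x) * (3 * k\<^sup>2 * d)) = x / d" for x
    using d by (simp_all add: divide_simps) (simp_all add: algebra_simps power_numeral_reduce)
  have half: "- (B + d) / (2 * d) = (X - 3 * u * v * w) / d" "(B - d) / (2 * d) = (3 * u * v * w - Y) / d"
    by (simp_all add: B_def XY divide_simps) (simp_all add: algebra_simps)
  show ?thesis
    using assms(1) disc
    unfolding hess mat_N.simps Let_def matrix2_eq_iff nth_map_matrix vector_2
    by (simp only: flip: k_def d_def) (simp only: cancel half flip: A_def C_def; simp)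
qed

lemma pulls_mat_T: 
  "pulls (mat_T F u) u u 1" "pulls (mat_T F u) v w (- (u - v) / (u - w))" "pulls (mat_T F u) w v (- (u - w) / (u - v))"
  using distinct unfolding mat_T_F pulls_def
  by (auto simp: divide_simps; simp add: algebra_simps power2_eq_square)+

lemma pulls_mat_N: 
  assumes "csqrt (- 3 * quadratic_disc (hessian F)) = 3 * of_int b3 ^ 2 * ((u - v) * (v - w) * (w - u))"
  shows "pulls (mat_N (hessian F)) v u ((v - w) / (w - u))"
  using distinct unfolding mat_N_hessian[OF assms] pulls_def
  by (auto simp: divide_simps; simp add: algebra_simps power_numeral_reduce)
end

section \<open>Classification of the automorphisms\<close>

declare hessian.simps [simp del] julia.simps [simp del] mat_N.simps [simp del]
  quadratic_disc.simps [simp del] cubic_disc.simps [simp del]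

lemma preserves_mat_1: "preserves F (mat 1)"
  by (simp add: preserves_def)

lemma preserves_mult:
  assumes "preserves F S" "preserves F T"
  shows "preserves F (S ** T)"
proof -
  have "(S ** T) $ i $ 1 * x + (S ** T) $ i $ 2 * y =
    S $ i $ 1 * (T $ 1 $ 1 * x + T $ 1 $ 2 * y) + S $ i $ 2 * (T $ 2 $ 1 * x + T $ 2 $ 2 * y)" for i x y
    by (simp add: matrix_mult2 algebra_simps)
  then show ?thesis
    using assms by (simp add: preserves_def)
qed

text \<open>For \<open>\<mu> = 0\<close> the condition \<open>pulls\<close> does not depend on
  \<open>\<eta>\<close>; requiring \<open>\<mu> \<noteq> 0\<close> makes \<open>\<eta>\<close> a
  function of \<open>T\<close> and \<open>\<theta>\<close>. Hiding the multiplier lets products be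
  followed on the roots alone.\<close>

definition moves :: "complex^2^2 \<Rightarrow> complex \<Rightarrow> complex \<Rightarrow> bool" where
  "moves T \<theta> \<eta> \<longleftrightarrow> (\<exists>\<mu>. \<mu> \<noteq> 0 \<and> pulls T \<theta> \<eta> \<mu>)"

lemma movesI: "pulls T \<theta> \<eta> \<mu> \<Longrightarrow> \<mu> \<noteq> 0 \<Longrightarrow> moves T \<theta> \<eta>"
  unfolding moves_def by blast

lemma moves_mult: "moves S \<theta> \<eta> \<Longrightarrow> moves T \<eta> \<zeta> \<Longrightarrow> moves (S ** T) \<theta> \<zeta>"
  unfolding moves_def using pulls_mult by (metis mult_eq_0_iff)

lemma moves_unique:
  assumes "moves T \<theta> \<eta>" "moves T \<theta> \<eta>'"
  shows "\<eta> = \<eta>'"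
proof -
  obtain \<mu> \<mu>' where "\<mu> \<noteq> 0" and p: "pulls T \<theta> \<eta> \<mu>" "pulls T \<theta> \<eta>' \<mu>'"
    using assms unfolding moves_def by blast
  have "\<mu> = \<mu>'" "- \<mu> * \<eta> = - \<mu>' * \<eta>'"
    using p unfolding pulls_def by metis+
  with \<open>\<mu> \<noteq> 0\<close> show ?thesis
    by simp
qed

text \<open>The factor \<open>e\<close> is the sign of the permutation of the roots.\<close>

lemma vandermonde_permutation:
  fixes u v w :: complex
  assumes "\<eta>1 \<in> {u, v, w}" "\<eta>2 \<in> {u, v, w}" "\<eta>3 \<in> {u, v, w}" "\<eta>1 \<noteq> \<eta>2" "\<eta>2 \<noteq> \<eta>3" "\<eta>3 \<noteq> \<eta>1"
  obtains e where "(\<eta>1 - \<eta>2) * (\<eta>2 - \<eta>3) * (\<eta>3 - \<eta>1) = e * ((u - v) * (v - w) * (w - u))" "e = 1 \<or> e = -1"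
proof -
  have "(\<eta>1 - \<eta>2) * (\<eta>2 - \<eta>3) * (\<eta>3 - \<eta>1) = 1 * ((u - v) * (v - w) * (w - u)) \<or>
    (\<eta>1 - \<eta>2) * (\<eta>2 - \<eta>3) * (\<eta>3 - \<eta>1) = -1 * ((u - v) * (v - w) * (w - u))"
    using assms by (elim insertE emptyE; simp) (simp_all add: algebra_simps)
  then show ?thesis
    using that by blast
qed

lemma rational_matrix_iff:
  "M \<in> range complex_mat \<longleftrightarrow> (\<forall>i j. M $ i $ j \<in> \<rat>)"
proof
  assume M: "\<forall>i j. M $ i $ j \<in> \<rat>"
  have "M = complex_mat (\<chi> i j. THE q. of_rat q = M $ i $ j)"
  proof -
    have "of_rat (THE q. of_rat q = M $ i $ j) = M $ i $ j" for i j
    proof -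
      obtain q where "M $ i $ j = of_rat q"
        using M Rats_cases by metis
      then show ?thesis
        by simp
    qed
    then show ?thesis
      by (simp add: vec_eq_iff)
  qed
  then show "M \<in> range complex_mat"
    by blast
qed auto

section \<open>Preserving matrices as permutations of the roots\<close>

context factored_cubic
begin

lemma preserves_if_pulls:
  assumes "pulls T u \<eta>1 \<mu>1" "pulls T v \<eta>2 \<mu>2" "pulls T w \<eta>3 \<mu>3" and prod: "\<mu>1 * \<mu>2 * \<mu>3 = 1"
    and perm: "\<And>x y. (x - \<eta>1 * y) * (x - \<eta>2 * y) * (x - \<eta>3 * y) = (x - u * y) * (x - v * y) * (x - w * y)"
  shows "preserves F T"
  unfolding preserves_def
proof (intro allI)
  fix x y
  have "eval_cubic F (T $ 1 $ 1 * x + T $ 1 $ 2 * y) (T $ 2 $ 1 * x + T $ 2 $ 2 * y) =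
    of_int b3 * (\<mu>1 * (x - \<eta>1 * y)) * (\<mu>2 * (x - \<eta>2 * y)) * (\<mu>3 * (x - \<eta>3 * y))"
    unfolding eval_F pulls_apply[OF assms(1)] pulls_apply[OF assms(2)] pulls_apply[OF assms(3)] ..
  also have "\<dots> = of_int b3 * (\<mu>1 * \<mu>2 * \<mu>3) * ((x - \<eta>1 * y) * (x - \<eta>2 * y) * (x - \<eta>3 * y))"
    by simp
  also have "\<dots> = eval_cubic F x y"
    unfolding prod perm eval_F by simp
  finally show "eval_cubic F (T $ 1 $ 1 * x + T $ 1 $ 2 * y) (T $ 2 $ 1 * x + T $ 2 $ 2 * y) = eval_cubic F x y" .
qed

lemma preserves_pulls_ex:
  assumes "preserves F T" "\<theta> \<in> {u, v, w}"
  obtains \<eta> \<mu> where "\<eta> \<in> {u, v, w}" "pulls T \<theta> \<eta> \<mu>"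
proof -
  define \<alpha> \<beta> where "\<alpha> = T $ 1 $ 1 - \<theta> * T $ 2 $ 1" and "\<beta> = T $ 1 $ 2 - \<theta> * T $ 2 $ 2"
  \<comment> \<open>Substituting \<open>T\<close> turns \<open>L\<^sub>\<theta>\<close> into
    \<open>\<alpha> x + \<beta> y\<close>, which vanishes at \<open>(\<beta>, - \<alpha>)\<close>.
    That point is a zero of \<open>F \<circ> T = F\<close>, hence of one of the factors
    \<open>L\<^sub>\<eta>\<close>.\<close>
  have "(T $ 1 $ 1 * \<beta> + T $ 1 $ 2 * - \<alpha>) - \<theta> * (T $ 2 $ 1 * \<beta> + T $ 2 $ 2 * - \<alpha>) = 0"
    by (simp add: \<alpha>_def \<beta>_def algebra_simps)
  then have "eval_cubic F (T $ 1 $ 1 * \<beta> + T $ 1 $ 2 * - \<alpha>) (T $ 2 $ 1 * \<beta> + T $ 2 $ 2 * - \<alpha>) = 0"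
    unfolding eval_F using assms(2) by auto
  then have "eval_cubic F \<beta> (- \<alpha>) = 0"
    using assms(1) unfolding preserves_def by metis
  then obtain \<eta> where "\<eta> \<in> {u, v, w}" "\<beta> - \<eta> * - \<alpha> = 0"
    unfolding eval_F using b3 by auto
  moreover from this(2) have "pulls T \<theta> \<eta> \<alpha>"
    by (simp add: pulls_def \<alpha>_def[symmetric] \<beta>_def[symmetric] eq_neg_iff_add_eq_0 mult.commute)
  ultimately show ?thesis
    using that by blast
qed

text \<open>Compares the coefficients of \<open>x^3\<close>, that is, the values at
  \<open>(1, 0)\<close>, where each \<open>L\<^sub>\<eta>\<close> takes the value 1.\<close>

lemma preserves_pulls_prod:
  assumes "preserves F T" "pulls T u \<eta>1 \<mu>1" "pulls T v \<eta>2 \<mu>2" "pulls T w \<eta>3 \<mu>3"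
  shows "\<mu>1 * \<mu>2 * \<mu>3 = 1"
proof -
  have "eval_cubic F (T $ 1 $ 1 * 1 + T $ 1 $ 2 * 0) (T $ 2 $ 1 * 1 + T $ 2 $ 2 * 0) = of_int b3 * (\<mu>1 * \<mu>2 * \<mu>3)"
    unfolding eval_F pulls_apply[OF assms(2)] pulls_apply[OF assms(3)] pulls_apply[OF assms(4)] by simp
  moreover have "eval_cubic F 1 0 = (of_int b3 :: complex)"
    by simp
  ultimately show ?thesis
    using assms(1) b3 unfolding preserves_def by (metis mult_cancel_left1 of_int_eq_0_iff)
qed

lemma pulls_distinct:
  assumes "det T \<noteq> 0" "pulls T u \<eta>1 \<mu>1" "pulls T v \<eta>2 \<mu>2" "pulls T w \<eta>3 \<mu>3"
  shows "\<eta>1 \<noteq> \<eta>2" "\<eta>2 \<noteq> \<eta>3" "\<eta>3 \<noteq> \<eta>1"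
  using pulls_det[OF assms(2,3)] pulls_det[OF assms(3,4)] pulls_det[OF assms(4,2)] assms(1) distinct by auto

text \<open>By \<open>pulls_multiplier\<close> the permutation determines the multipliers, so
  \<open>S\<close> and \<open>T\<close> agree on the independent forms \<open>L\<^sub>u\<close> and
  \<open>L\<^sub>v\<close>.\<close>

lemma preserves_eqI:
  assumes S: "preserves F S" "det S \<in> \<real>" "pulls S u \<eta>1 \<mu>1" "pulls S v \<eta>2 \<mu>2" "pulls S w \<eta>3 \<mu>3"
    and T: "preserves F T" "det T \<in> \<real>" "pulls T u \<eta>1 \<nu>1" "pulls T v \<eta>2 \<nu>2" "pulls T w \<eta>3 \<nu>3"
    and \<eta>: "\<eta>1 \<in> {u, v, w}" "\<eta>2 \<in> {u, v, w}" "\<eta>3 \<in> {u, v, w}" "\<eta>1 \<noteq> \<eta>2" "\<eta>2 \<noteq> \<eta>3" "\<eta>3 \<noteq> \<eta>1"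
  shows "S = T"
proof -
  obtain e where e: "(\<eta>1 - \<eta>2) * (\<eta>2 - \<eta>3) * (\<eta>3 - \<eta>1) = e * ((u - v) * (v - w) * (w - u))" "e = 1 \<or> e = -1"
    using vandermonde_permutation[OF \<eta>] by blast
  note mult = pulls_multiplier[OF _ _ _ distinct \<eta>(4-6) _ _ e]
  have "\<mu>1 = \<nu>1" "\<mu>2 = \<nu>2"
    using mult[OF S(3-5) preserves_pulls_prod[OF S(1,3-5)] S(2)] mult[OF T(3-5) preserves_pulls_prod[OF T(1,3-5)] T(2)]
    by simp_all
  then show ?thesis
    using pulls_unique[OF S(3,4)] T(3,4) distinct by blast
qed

lemma mat_T_multipliers: "- (u - v) / (u - w) * (- (u - w) / (u - v)) = 1"
  using distinct by (simp add: divide_simps) (simp add: algebra_simps)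

lemma det_mat_T: "det (mat_T F u) = -1"
proof -
  have "(v - w) * det (mat_T F u) = (v - w) * -1"
    unfolding pulls_det[OF pulls_mat_T(2,3)] mat_T_multipliers by simp
  then show ?thesis
    by (rule mult_left_cancel[THEN iffD1, rotated]) (use distinct in simp)
qed

lemma preserves_mat_T: "preserves F (mat_T F u)"
proof (rule preserves_if_pulls[OF pulls_mat_T])
  show "1 * (- (u - v) / (u - w)) * (- (u - w) / (u - v)) = 1"
    unfolding mult_1 by (rule mat_T_multipliers)
qed simp

lemma w_eq: "w = - of_int b2 / of_int b3 - u - v"
  using b3 by (simp add: b2 field_simps)

text \<open>Because \<open>L\<^sub>u\<close> is fixed with multiplier 1, \<open>u\<close> can be
  solved for from the entries of the matrix. If the lower left entry is 0, determinant
  \<open>-1\<close> makes the lower right entry \<open>-1\<close>, and the upper right entry is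
  \<open>- 2 u\<close>. Conversely, the covariants have coefficients polynomial in \<open>u\<close>
  over the rationals.\<close>

lemma mat_T_rational_iff: "mat_T F u \<in> range complex_mat \<longleftrightarrow> u \<in> \<rat>"
proof
  assume "mat_T F u \<in> range complex_mat"
  then have r: "mat_T F u $ i $ j \<in> \<rat>" for i j
    by auto
  have p: "mat_T F u $ 1 $ 1 - u * mat_T F u $ 2 $ 1 = 1" "mat_T F u $ 1 $ 2 - u * mat_T F u $ 2 $ 2 = - u"
    using pulls_mat_T(1) by (simp_all add: pulls_def)
  show "u \<in> \<rat>"
  proof (cases "mat_T F u $ 2 $ 1 = 0")
    case True
    then have "mat_T F u $ 2 $ 2 = -1"
      using p det_mat_T by (simp add: det_2)
    with p(2) have "mat_T F u $ 1 $ 2 = - u - u"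
      by (metis add.inverse_inverse add_diff_cancel_right' diff_minus_eq_add mult_minus1_right)
    then have "u = - mat_T F u $ 1 $ 2 / 2"
      by simp
    then show ?thesis
      using r by (metis Rats_divide Rats_minus_iff Rats_number_of)
  next
    case False
    then have "u = (mat_T F u $ 1 $ 1 - 1) / mat_T F u $ 2 $ 1"
      using p(1) by (simp add: eq_divide_eq diff_eq_eq eq_diff_eq add.commute)
    then show ?thesis
      using r by (metis Rats_diff Rats_divide Rats_1)
  qed
next
  assume u: "u \<in> \<rat>"
  have "mat_T F u $ i $ j \<in> \<rat>" for i j
  proof -
    have "julia F u = Quadratic a b c \<Longrightarrow> a \<in> \<rat> \<and> b \<in> \<rat> \<and> c \<in> \<rat>" for a b c
      using u by (auto simp: julia.simps Let_def)
    moreover have "hessian F = Quadratic a b c \<Longrightarrow> a \<in> \<rat> \<and> b \<in> \<rat> \<and> c \<in> \<rat>" for a b c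
      by (auto simp: hessian.simps)
    moreover obtain a b c a' b' c' where "julia F u = Quadratic a b c" "hessian F = Quadratic a' b' c'"
      by (metis quadratic.exhaust)
    ultimately show ?thesis
      using exhaust_2[of i] exhaust_2[of j] by (auto simp: mat_T_def matrix_mult2)
  qed
  then show "mat_T F u \<in> range complex_mat"
    by (simp add: rational_matrix_iff)
qed

end
lemma of_rat_in_Reals: "of_rat q \<in> (\<real> :: complex set)"
proof (cases q)
  case (Fract a b)
  then show ?thesis
    by (simp add: of_rat_rat)
qed

text \<open>The integers are integrally closed: in lowest terms \<open>a / b\<close>, the relation
  \<open>n * b\<^sup>2 = a\<^sup>2\<close> gives \<open>b dvd a\<close>, so
  \<open>b = 1\<close>.\<close>

lemma int_square_if_rat_square:
  assumes "of_int n = (q :: complex)\<^sup>2" "q \<in> \<rat>"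
  shows "is_square n"
proof -
  obtain r where "q = of_rat r"
    using assms(2) Rats_cases by blast
  then have "of_rat (of_int n) = (of_rat (r\<^sup>2) :: complex)"
    using assms(1) by (simp add: of_rat_power)
  then have r: "of_int n = r\<^sup>2"
    unfolding of_rat_eq_iff .
  obtain a b where ab: "quotient_of r = (a, b)"
    by fastforce
  then have "r = of_int a / of_int b" "b > 0" "coprime a b"
    by (simp_all add: quotient_of_div quotient_of_denom_pos quotient_of_coprime)
  with r have "of_int (n * b\<^sup>2) = (of_int (a\<^sup>2) :: rat)"
    by (simp add: power_divide)
  then have nb: "n * b\<^sup>2 = a\<^sup>2"
    unfolding of_int_eq_iff .
  then have "b dvd a"
    using pow_divides_pow_iff[of 2 b a] by (metis dvd_triv_right pos2)
  then have "is_unit b"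
    using \<open>coprime a b\<close> coprime_absorb_right by blast
  then have "b = 1"
    using \<open>b > 0\<close> by simp
  with nb show ?thesis
    by (auto intro: is_nth_powerI)
qed

text \<open>
  Exchanging two roots changes the sign of the right-hand side, so every cubic has a labelling
  of its roots that agrees with the principal square root.
\<close>
locale oriented_cubic = factored_cubic +
  assumes csqrt: "csqrt (- 3 * quadratic_disc (hessian F)) = 3 * of_int b3 ^ 2 * ((u - v) * (v - w) * (w - u))"
begin

abbreviation "N \<equiv> mat_N (hessian F)"

lemma rotate_oriented: "oriented_cubic b3 b2 b1 b0 v w u"
  by (intro oriented_cubic.intro rotate oriented_cubic_axioms.intro, subst csqrt) simp

text \<open>The matrix \<open>N\<close> does not depend on the labelling, and the orientation
  survives cyclic rotation, so one arc of the 3-cycle gives the other two.\<close>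

lemma pulls_N:
  "pulls N u w ((u - v) / (v - w))" "pulls N v u ((v - w) / (w - u))" "pulls N w v ((w - u) / (u - v))"
proof -
  interpret R: oriented_cubic b3 b2 b1 b0 v w u
    by (rule rotate_oriented)
  interpret S: oriented_cubic b3 b2 b1 b0 w u v
    by (rule R.rotate_oriented)
  show "pulls N u w ((u - v) / (v - w))"
    by (rule S.pulls_mat_N[OF S.csqrt])
  show "pulls N v u ((v - w) / (w - u))"
    by (rule pulls_mat_N[OF csqrt])
  show "pulls N w v ((w - u) / (u - v))"
    by (rule R.pulls_mat_N[OF R.csqrt])
qed

lemma det_N: "det N = 1"
proof -
  have "(v - w) * det N = (v - w) * 1"
    unfolding pulls_det[OF pulls_N(2,3)] using distinct by simp
  then show ?thesis
    by (rule mult_left_cancel[THEN iffD1, rotated]) (use distinct in simp)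
qed

lemma preserves_N: "preserves F N"
  by (rule preserves_if_pulls[OF pulls_N]) (use distinct in auto)

lemma moves_N: "moves N u w" "moves N v u" "moves N w v"
  by (rule pulls_N[THEN movesI], use distinct in simp)+

text \<open>The condition \<open>det T \<in> {1, -1}\<close> is stable under products and makes the
  determinant real, as \<open>preserves_eqI\<close> requires.\<close>

definition perm :: "complex^2^2 \<Rightarrow> complex \<Rightarrow> complex \<Rightarrow> complex \<Rightarrow> bool" where
  "perm T \<eta>1 \<eta>2 \<eta>3 \<longleftrightarrow> preserves F T \<and> det T \<in> {1, -1} \<and> moves T u \<eta>1 \<and> moves T v \<eta>2 \<and> moves T w \<eta>3"

lemma perm_mat_T: "perm (mat_T F u) u w v"
proof -
  have "moves (mat_T F u) u u" "moves (mat_T F u) v w" "moves (mat_T F u) w v"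
    by (rule pulls_mat_T[THEN movesI], use distinct in simp)+
  then show ?thesis
    by (simp add: perm_def det_mat_T preserves_mat_T)
qed

lemma perm_rotate: "oriented_cubic.perm b3 b2 b1 b0 v w u T \<eta>1 \<eta>2 \<eta>3 \<longleftrightarrow> perm T \<eta>3 \<eta>1 \<eta>2"
  unfolding perm_def oriented_cubic.perm_def[OF rotate_oriented] by blast

lemma perm_list:
  "perm (mat 1) u v w" "perm N w u v" 
  "perm (mat_T F u) u w v" "perm (mat_T F v) w v u" "perm (mat_T F w) v u w"
proof -
  interpret R: oriented_cubic b3 b2 b1 b0 v w u
    by (rule rotate_oriented)
  interpret S: oriented_cubic b3 b2 b1 b0 w u v
    by (rule R.rotate_oriented)
  have "moves (mat 1) \<theta> \<theta>" for \<theta>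
    by (rule movesI[OF pulls_mat_1]) simp
  then show "perm (mat 1) u v w"
    by (simp add: perm_def preserves_mat_1)
  show "perm N w u v"
    by (simp add: perm_def preserves_N det_N moves_N)
  show "perm (mat_T F u) u w v"
    by (rule perm_mat_T)
  show "perm (mat_T F v) w v u" 
    using R.perm_mat_T unfolding perm_rotate .
  show "perm (mat_T F w) v u w"
    using S.perm_mat_T unfolding R.perm_rotate perm_rotate .
qed

lemma perm_mult:
  assumes "perm S \<eta>1 \<eta>2 \<eta>3" "preserves F T" "det T \<in> {1, -1}"
    "moves T \<eta>1 \<zeta>1" "moves T \<eta>2 \<zeta>2" "moves T \<eta>3 \<zeta>3"
  shows "perm (S ** T) \<zeta>1 \<zeta>2 \<zeta>3"
  using assms moves_mult unfolding perm_def
  by (auto simp: preserves_mult det_mul)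

lemma perm_mult_N:
  assumes "perm S \<eta>1 \<eta>2 \<eta>3" "moves N \<eta>1 \<zeta>1" "moves N \<eta>2 \<zeta>2" "moves N \<eta>3 \<zeta>3"
  shows "perm (S ** N) \<zeta>1 \<zeta>2 \<zeta>3"
  using perm_mult[OF assms(1) _ _ assms(2-4)] by (simp add: preserves_N det_N)

lemma moves_T: "moves (mat_T F u) u u" "moves (mat_T F u) v w" "moves (mat_T F u) w v"
  using perm_mat_T by (simp_all add: perm_def)

lemma perm_mult_T:
  assumes "perm S \<eta>1 \<eta>2 \<eta>3" "moves (mat_T F u) \<eta>1 \<zeta>1" "moves (mat_T F u) \<eta>2 \<zeta>2" "moves (mat_T F u) \<eta>3 \<zeta>3"
  shows "perm (S ** mat_T F u) \<zeta>1 \<zeta>2 \<zeta>3"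
  using perm_mult[OF assms(1) _ _ assms(2-4)] by (simp add: preserves_mat_T det_mat_T)

text \<open>Reduces each relation below among \<open>N\<close> and the matrices \<open>mat_T\<close>
  to a comparison of permutations of the roots.\<close>

lemma perm_unique:
  assumes "perm S \<eta>1 \<eta>2 \<eta>3" "perm T \<eta>1 \<eta>2 \<eta>3" "\<eta>1 \<in> {u, v, w}" "\<eta>2 \<in> {u, v, w}" "\<eta>3 \<in> {u, v, w}"
    "\<eta>1 \<noteq> \<eta>2" "\<eta>2 \<noteq> \<eta>3" "\<eta>3 \<noteq> \<eta>1"
  shows "S = T"
proof -
  have "det S \<in> \<real>" "det T \<in> \<real>"
    using assms(1,2) by (auto simp: perm_def)
  moreover obtain \<mu>1 \<mu>2 \<mu>3 where "pulls S u \<eta>1 \<mu>1" "pulls S v \<eta>2 \<mu>2" "pulls S w \<eta>3 \<mu>3"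
    using assms(1) unfolding perm_def moves_def by blast
  moreover obtain \<nu>1 \<nu>2 \<nu>3 where "pulls T u \<eta>1 \<nu>1" "pulls T v \<eta>2 \<nu>2" "pulls T w \<eta>3 \<nu>3"
    using assms(2) unfolding perm_def moves_def by blast
  moreover have "preserves F S" "preserves F T"
    using assms(1,2) by (simp_all add: perm_def)
  ultimately show ?thesis
    using preserves_eqI assms(3-8) by blast
qed

lemma perm_NN: "perm (N ** N) v w u"
  by (rule perm_mult_N[OF perm_list(2)]; rule moves_N)

lemma N_cubed: "N ** N ** N = mat 1"
  by (rule perm_unique[OF perm_mult_N[OF perm_NN] perm_list(1)], (rule moves_N)+) (use distinct in auto)

lemma T_squared: "mat_T F u ** mat_T F u = mat 1"
  by (rule perm_unique[OF perm_mult_T[OF perm_mat_T] perm_list(1)], (rule moves_T)+) (use distinct in auto)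

lemma N_mult_T: "N ** mat_T F u = mat_T F w"
  by (rule perm_unique[OF perm_mult_T[OF perm_list(2)] perm_list(5)], (rule moves_T)+) (use distinct in auto)

lemma NN_mult_T: "N ** N ** mat_T F u = mat_T F v"
  by (rule perm_unique[OF perm_mult_T[OF perm_NN] perm_list(4)], (rule moves_T)+) (use distinct in auto)

lemma T_mult_N: "mat_T F u ** N = mat_T F v"
  by (rule perm_unique[OF perm_mult_N[OF perm_list(3)] perm_list(4)], (rule moves_N)+) (use distinct in auto)

lemma distinct_automorphisms: "distinct [mat 1, N, N ** N, mat_T F u, mat_T F v, mat_T F w]"
proof -
  \<comment> \<open>The images of \<open>u\<close> and \<open>v\<close> already separate the six
    permutations.\<close>
  let ?f = "\<lambda>T. (THE \<eta>. moves T u \<eta>, THE \<eta>. moves T v \<eta>)"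
  have f: "?f T = (\<eta>1, \<eta>2)" if "perm T \<eta>1 \<eta>2 \<eta>3" for T \<eta>1 \<eta>2 \<eta>3
    using that moves_unique by (auto simp: perm_def)
  have "distinct (map ?f [mat 1, N, N ** N, mat_T F u, mat_T F v, mat_T F w])"
    unfolding list.map perm_list[THEN f] perm_NN[THEN f] using distinct by simp
  then show ?thesis
    unfolding distinct_map by blast
qed

lemma preserves_cases:
  assumes "preserves F T" "det T \<in> \<real>" "det T \<noteq> 0"
  shows "T \<in> {mat 1, N, N ** N, mat_T F u, mat_T F v, mat_T F w}"
proof -
  obtain \<eta>1 \<mu>1 where 1: "\<eta>1 \<in> {u, v, w}" "pulls T u \<eta>1 \<mu>1"
    by (rule preserves_pulls_ex[OF assms(1), of u]) auto
  obtain \<eta>2 \<mu>2 where 2: "\<eta>2 \<in> {u, v, w}" "pulls T v \<eta>2 \<mu>2"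
    by (rule preserves_pulls_ex[OF assms(1), of v]) auto
  obtain \<eta>3 \<mu>3 where 3: "\<eta>3 \<in> {u, v, w}" "pulls T w \<eta>3 \<mu>3"
    by (rule preserves_pulls_ex[OF assms(1), of w]) auto
  note dist = pulls_distinct[OF assms(3) 1(2) 2(2) 3(2)]
  \<comment> \<open>\<open>perm_unique\<close> is not applicable to \<open>T\<close>, whose
    determinant is so far only known to be real and non-zero.\<close>
  have eq: "T = S" if S: "perm S \<eta>1 \<eta>2 \<eta>3" for S
  proof -
    have "det S \<in> \<real>" "preserves F S"
      using S by (auto simp: perm_def)
    moreover obtain \<nu>1 \<nu>2 \<nu>3 where "pulls S u \<eta>1 \<nu>1" "pulls S v \<eta>2 \<nu>2" "pulls S w \<eta>3 \<nu>3"
      using S unfolding perm_def moves_def by blast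
    ultimately show ?thesis
      using preserves_eqI[OF assms(1,2) 1(2) 2(2) 3(2)] 1(1) 2(1) 3(1) dist by blast
  qed
  have "perm (mat 1) \<eta>1 \<eta>2 \<eta>3 \<or> perm N \<eta>1 \<eta>2 \<eta>3 \<or> perm (N ** N) \<eta>1 \<eta>2 \<eta>3 \<or>
    perm (mat_T F u) \<eta>1 \<eta>2 \<eta>3 \<or> perm (mat_T F v) \<eta>1 \<eta>2 \<eta>3 \<or> perm (mat_T F w) \<eta>1 \<eta>2 \<eta>3"
    using 1(1) 2(1) 3(1) dist by (elim insertE emptyE) (simp_all only: perm_list perm_NN simp_thms)
  with eq show ?thesis
    by blast
qed

lemma Aut_eq: "complex_mat ` Aut F = {mat 1, N, N ** N, mat_T F u, mat_T F v, mat_T F w} \<inter> range complex_mat"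
proof (intro equalityI subsetI)
  fix M assume "M \<in> complex_mat ` Aut F"
  then obtain T where M: "M = complex_mat T" "det T \<noteq> 0" "preserves F M"
    by (auto simp: Aut_iff)
  then have "det M \<in> \<real>" "det M \<noteq> 0"
    by (auto simp: det_complex_mat of_rat_in_Reals)
  then show "M \<in> {mat 1, N, N ** N, mat_T F u, mat_T F v, mat_T F w} \<inter> range complex_mat"
    using preserves_cases M by blast
next
  fix M assume M: "M \<in> {mat 1, N, N ** N, mat_T F u, mat_T F v, mat_T F w} \<inter> range complex_mat"
  then have "preserves F M" "det M \<in> {1, -1}"
    using perm_list perm_NN unfolding perm_def by blast+
  moreover obtain T where "M = complex_mat T"
    using M by blast
  ultimately have "T \<in> Aut F"
    by (auto simp: Aut_iff det_complex_mat)
  then show "M \<in> complex_mat ` Aut F"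
    using \<open>M = complex_mat T\<close> by blast
qed

end

section \<open>Passage between rational and complex matrices\<close>

lemma complex_mat_mult: "complex_mat (S ** T) = complex_mat S ** complex_mat T"
  for S T :: "rat^2^2"
  by (simp add: matrix2_eq_iff matrix_mult2 of_rat_add of_rat_mult)

lemma complex_mat_1: "complex_mat (mat 1) = mat 1"
  by (simp add: matrix2_eq_iff)

lemma inj_complex_mat: "inj complex_mat"
  by (rule injI) (simp add: vec_eq_iff)

lemma card_complex_mat_image: "card (complex_mat ` A) = card A"
  by (rule card_image) (rule inj_on_subset[OF inj_complex_mat subset_UNIV])

lemma (in group) int_pow_2: "x \<in> carrier G \<Longrightarrow> x [^] (2::int) = x \<otimes> x"
  by (metis int_pow_mult int_pow_1 one_add_one)

lemma Aut_subset: "Aut F \<subseteq> carrier GL2Q"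
  by (auto simp: Aut_def)

lemma GL2Q_simps: "monoid.mult GL2Q = (**)" "one GL2Q = mat 1"
  by (simp_all add: GL2Q_def)

text \<open>Since \<open>Aut F\<close> has \<open>n\<close> elements, powers of \<open>x\<close>
  with exponents in \<open>{0..<int n}\<close> that cover it must be distinct.\<close>

lemma Aut_cyclicI:
  assumes x: "x \<in> Aut F" "x [^]\<^bsub>GL2Q\<^esub> n = mat 1" and n: "n > 0" "card (Aut F) = n"
    and img: "(\<lambda>i::int. x [^]\<^bsub>GL2Q\<^esub> i) ` {0..<int n} = Aut F"
  shows "Aut_generated_by F (complex_mat x) \<and> Aut_group F \<cong> integer_mod_group n"
proof -
  interpret group GL2Q
    by (rule group_GL2Q)
  have xc: "x \<in> carrier GL2Q" "x [^]\<^bsub>GL2Q\<^esub> n = one GL2Q"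
    using x Aut_subset by (auto simp: GL2Q_simps)
  have "inj_on (\<lambda>i::int. x [^]\<^bsub>GL2Q\<^esub> i) {0..<int n}"
    by (rule eq_card_imp_inj_on) (simp_all add: img n)
  then have "bij_betw (\<lambda>i::int. x [^]\<^bsub>GL2Q\<^esub> i) {0..<int n} (Aut F)"
    by (simp add: bij_betw_def img)
  then have "Aut_group F \<cong> integer_mod_group n"
    unfolding Aut_group_def by (rule iso_integer_mod_group[OF xc n(1)])
  moreover have "Aut F = generate GL2Q {x}"
    using generate_singleton_finite_order[OF xc n(1)] img by simp
  ultimately show ?thesis
    using xc(1) by (auto simp: Aut_generated_by_def)
qed

section \<open>Rationality of the covariant matrices and of the roots\<close>

context oriented_cubic
begin

lemma disc_nonzero: "cubic_disc F \<noteq> 0"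
proof -
  have "of_int (cubic_disc F) \<noteq> (0::complex)"
    unfolding disc_F using b3 distinct by simp
  then show ?thesis
    by simp
qed

text \<open>The square root \<open>s\<close> in \<open>mat_N\<close> satisfies
  \<open>s\<^sup>2 = 9 * cubic_disc F\<close>. The entries of \<open>N\<close> determine
  \<open>a s\<close> and \<open>b s\<close>, and \<open>a\<close>, \<open>b\<close> are not both 0
  since \<open>D \<noteq> 0\<close>, so \<open>N\<close> is rational exactly when \<open>s\<close>
  is.\<close>

lemma N_rational_iff: "N \<in> range complex_mat \<longleftrightarrow> is_square (cubic_disc F)"
proof -
  obtain a b c where h: "hessian F = Quadratic a b c"
    by (metis quadratic.exhaust)
  then have abc: "a \<in> \<rat>" "b \<in> \<rat>" "c \<in> \<rat>"
    by (auto simp: hessian.simps)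
  define D where "D = quadratic_disc (hessian F)"
  define s where "s = csqrt (- 3 * D)"
  have D: "D = - 3 * of_int (cubic_disc F)" "D \<noteq> 0" "D = b\<^sup>2 - 4 * a * c"
    using disc_nonzero by (simp_all add: D_def quadratic_disc_hessian)
      (simp only: quadratic_disc.simps h flip: quadratic_disc_hessian mult_minus_left)
  have DQ: "D \<in> \<rat>"
    by (simp add: D(1))
  have s2: "s\<^sup>2 = 9 * of_int (cubic_disc F)"
    by (simp add: s_def D(1))
  have N: "N $ 1 $ 1 = 1 / (2 * D) * (b * s - D)" "N $ 1 $ 2 = 1 / (2 * D) * (2 * c * s)"
    "N $ 2 $ 1 = 1 / (2 * D) * (- 2 * a * s)" "N $ 2 $ 2 = 1 / (2 * D) * (- b * s - D)"
    by (simp_all add: h mat_N.simps Let_def s_def D_def)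
  show ?thesis
  proof
    assume "N \<in> range complex_mat"
    then have r: "N $ i $ j \<in> \<rat>" for i j
      by auto
    have bcs: "b * s = D * (N $ 1 $ 1 - N $ 2 $ 2)" "c * s = D * N $ 1 $ 2" "a * s = - D * N $ 2 $ 1"
      using D(2) by (simp_all add: N field_simps)
    have q: "x * s \<in> \<rat> \<Longrightarrow> x \<in> \<rat> \<Longrightarrow> x \<noteq> 0 \<Longrightarrow> s \<in> \<rat>" for x
      using Rats_divide[of "x * s" x] by simp
    have "a \<noteq> 0 \<or> b \<noteq> 0"
      using D(2,3) by auto
    then have "s \<in> \<rat>"
      using q[of a] q[of b] abc bcs r DQ by auto
    moreover have "of_int (cubic_disc F) = (s / 3)\<^sup>2"
      by (simp add: power_divide s2)
    ultimately show "is_square (cubic_disc F)"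
      by (intro int_square_if_rat_square[of _ "s / 3"]) simp_all
  next
    assume "is_square (cubic_disc F)"
    then obtain m where "cubic_disc F = m\<^sup>2"
      by (rule is_nth_powerE)
    then have "s\<^sup>2 = (3 * of_int m)\<^sup>2"
      by (simp add: s2 power_mult_distrib)
    then have "s = 3 * of_int m \<or> s = - (3 * of_int m)"
      by (simp only: power2_eq_iff)
    then have "s \<in> \<rat>"
      by auto
    then have "N $ i $ j \<in> \<rat>" for i j
      using exhaust_2[of i] exhaust_2[of j] abc DQ by (auto simp: N)
    then show "N \<in> range complex_mat"
      by (simp add: rational_matrix_iff)
  qed
qed

text \<open>As \<open>N\<close> has cube 1, it is the square of \<open>N ** N\<close>.\<close>

lemma NN_rational_iff: "N ** N \<in> range complex_mat \<longleftrightarrow> N \<in> range complex_mat"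
proof -
  have mult: "A ** B \<in> range complex_mat" if "A \<in> range complex_mat" "B \<in> range complex_mat" for A B
    using that by (auto simp flip: complex_mat_mult)
  have "(N ** N) ** (N ** N) = N"
    by (metis N_cubed matrix_mul_assoc matrix_mul_lid)
  then show ?thesis
    using mult[of N N] mult[of "N ** N" "N ** N"] by auto
qed

lemma third_root_rational: "u \<in> \<rat> \<Longrightarrow> v \<in> \<rat> \<Longrightarrow> w \<in> \<rat>"
  by (subst w_eq) simp

text \<open>\<open>N\<close> turns \<open>L\<^sub>u\<close> into a multiple of
  \<open>L\<^sub>w\<close>, so \<open>w\<close> is a quotient of coefficients that are rational when
  \<open>N\<close> and \<open>u\<close> are.\<close>

lemma rational_root_if_N_rational:
  assumes "N \<in> range complex_mat" "u \<in> \<rat>"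
  shows "w \<in> \<rat>"
proof -
  have r: "N $ i $ j \<in> \<rat>" for i j
    using assms(1) by auto
  obtain \<mu> where \<mu>: "\<mu> \<noteq> 0" "pulls N u w \<mu>"
    using moves_N(1) unfolding moves_def by blast
  then have "w = - (N $ 1 $ 2 - u * N $ 2 $ 2) / (N $ 1 $ 1 - u * N $ 2 $ 1)"
    by (simp add: pulls_def)
  then show ?thesis
    using r assms(2) by (metis Rats_minus_iff Rats_diff Rats_mult Rats_divide)
qed

lemma eval_F_eq_0_iff: "eval_cubic F \<theta> 1 = 0 \<longleftrightarrow> \<theta> \<in> {u, v, w}"
  unfolding eval_F using b3 by auto

lemma rational_root_iff: "eval_cubic F r 1 = (0::rat) \<longleftrightarrow> of_rat r \<in> {u, v, w}"
proof -
  have "eval_cubic F r 1 = 0 \<longleftrightarrow> of_rat (eval_cubic F r 1) = (0::complex)"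
    by simp
  then show ?thesis
    unfolding of_rat_eval_cubic of_rat_1 eval_F_eq_0_iff .
qed

lemma irreducible_iff: "irreducible (form F) \<longleftrightarrow> {u, v, w} \<inter> \<rat> = {}"
  unfolding irreducible_form_iff[OF refl b3] rational_root_iff by (auto simp: Rats_def)

lemma sole_iff: "sole_rational_linear_factor F \<theta> \<longleftrightarrow> {u, v, w} \<inter> \<rat> = {\<theta>}"
proof
  assume "sole_rational_linear_factor F \<theta>"
  then obtain r where r: "\<theta> = of_rat r" "{r. of_rat r \<in> {u, v, w}} = {r}"
    unfolding sole_rational_linear_factor_iff[OF refl b3] rational_root_iff by blast
  have mem: "of_rat q \<in> {u, v, w} \<longleftrightarrow> q = r" for q
    using r(2) by (metis mem_Collect_eq singleton_iff)
  show "{u, v, w} \<inter> \<rat> = {\<theta>}"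
  proof (intro equalityI subsetI)
    fix x assume "x \<in> {u, v, w} \<inter> \<rat>"
    then show "x \<in> {\<theta>}"
      using mem r(1) by (metis IntD1 IntD2 Rats_cases singleton_iff)
  next
    fix x assume "x \<in> {\<theta>}"
    then show "x \<in> {u, v, w} \<inter> \<rat>"
      using mem[of r] r(1) by simp
  qed
next
  assume *: "{u, v, w} \<inter> \<rat> = {\<theta>}"
  then obtain r where r: "\<theta> = of_rat r"
    unfolding Rats_def by blast
  have "r' = r \<longleftrightarrow> of_rat r' \<in> {u, v, w} \<inter> \<rat>" for r'
    unfolding * r by simp
  then have "{r. of_rat r \<in> {u, v, w}} = {r}"
    by auto
  with r show "sole_rational_linear_factor F \<theta>"
    unfolding sole_rational_linear_factor_iff[OF refl b3] rational_root_iff by blast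
qed

lemma splits_iff: "splits_over_rat F \<longleftrightarrow> {u, v, w} \<subseteq> \<rat>"
proof
  assume "splits_over_rat F"
  then show "{u, v, w} \<subseteq> \<rat>"
    using splits_over_rat_imp_rational_root[OF refl b3] eval_F_eq_0_iff by blast
next
  assume "{u, v, w} \<subseteq> \<rat>"
  then obtain r1 r2 r3 where r: "u = of_rat r1" "v = of_rat r2" "w = of_rat r3"
    by (auto elim!: Rats_cases)
  have "of_rat (of_int b2) = (of_rat (- of_int b3 * (r1 + r2 + r3)) :: complex)"
    "of_rat (of_int b1) = (of_rat (of_int b3 * (r1 * r2 + r2 * r3 + r3 * r1)) :: complex)"
    "of_rat (of_int b0) = (of_rat (- of_int b3 * (r1 * r2 * r3)) :: complex)"
    by (simp_all add: b2 b1 b0 r of_rat_mult of_rat_add of_rat_minus)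
  then have "form F = linear_form (of_int b3) (- of_int b3 * r1) * linear_form 1 (- r2) * linear_form 1 (- r3)"
    unfolding of_rat_eq_iff by (simp add: form_Cubic linear_form_pCons algebra_simps)
  then show "splits_over_rat F"
    unfolding splits_over_rat_def by blast
qed

lemma T_rational_iff: "mat_T F \<theta> \<in> range complex_mat \<longleftrightarrow> \<theta> \<in> \<rat>" if "\<theta> \<in> {u, v, w}"
proof -
  interpret R: oriented_cubic b3 b2 b1 b0 v w u
    by (rule rotate_oriented)
  interpret S: oriented_cubic b3 b2 b1 b0 w u v
    by (rule R.rotate_oriented)
  show ?thesis
    using that mat_T_rational_iff R.mat_T_rational_iff S.mat_T_rational_iff by auto
qed

lemma Aut_irreducible:
  assumes "{u, v, w} \<inter> \<rat> = {}"
  shows "complex_mat ` Aut F = (if is_square (cubic_disc F) then {mat 1, N, N ** N} else {mat 1})"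
proof -
  have "mat_T F u \<notin> range complex_mat" "mat_T F v \<notin> range complex_mat" "mat_T F w \<notin> range complex_mat"
    using T_rational_iff assms by auto
  moreover have "mat 1 \<in> range complex_mat"
    using complex_mat_1 by (metis rangeI)
  ultimately show ?thesis
    unfolding Aut_eq using NN_rational_iff N_rational_iff by auto
qed

lemma Aut_one_root:
  assumes "{u, v, w} \<inter> \<rat> = {u}"
  shows "complex_mat ` Aut F = {mat 1, mat_T F u}"
proof -
  have "x \<in> \<rat> \<longleftrightarrow> x = u" if "x \<in> {u, v, w}" for x
    using that assms by blast
  from this[of u] this[of v] this[of w] have uvw: "u \<in> \<rat>" "v \<notin> \<rat>" "w \<notin> \<rat>"
    using distinct by simp_all
  then have "mat_T F u \<in> range complex_mat" "mat_T F v \<notin> range complex_mat" "mat_T F w \<notin> range complex_mat"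
    using T_rational_iff by auto
  moreover have "mat 1 \<in> range complex_mat"
    using complex_mat_1 by (metis rangeI)
  moreover have "N \<notin> range complex_mat" "N ** N \<notin> range complex_mat"
    using rational_root_if_N_rational uvw NN_rational_iff by auto
  ultimately show ?thesis
    unfolding Aut_eq by auto
qed

text \<open>By \<open>disc_F\<close>, rational roots make the discriminant the square of a rational
  number, so \<open>N\<close> is rational too.\<close>

lemma Aut_split:
  assumes "{u, v, w} \<subseteq> \<rat>"
  shows "complex_mat ` Aut F = {mat 1, N, N ** N, mat_T F u, mat_T F v, mat_T F w}"
proof -
  have "is_square (cubic_disc F)"
    by (rule int_square_if_rat_square[OF disc_F]) (use assms in simp)
  then have "N \<in> range complex_mat" "N ** N \<in> range complex_mat"
    using N_rational_iff NN_rational_iff by auto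
  moreover have "mat_T F u \<in> range complex_mat" "mat_T F v \<in> range complex_mat" "mat_T F w \<in> range complex_mat"
    using T_rational_iff assms by auto
  moreover have "mat 1 \<in> range complex_mat"
    using complex_mat_1 by (metis rangeI)
  ultimately show ?thesis
    unfolding Aut_eq by blast
qed

text \<open>Exactly two rational roots cannot occur, because the sum of all three is
  rational.\<close>

lemma rational_roots_cases:
  obtains "{u, v, w} \<inter> \<rat> = {}" | \<theta> where "\<theta> \<in> {u, v, w}" "{u, v, w} \<inter> \<rat> = {\<theta>}" | "{u, v, w} \<subseteq> \<rat>"
proof -
  interpret R: oriented_cubic b3 b2 b1 b0 v w u
    by (rule rotate_oriented)
  interpret S: oriented_cubic b3 b2 b1 b0 w u v
    by (rule R.rotate_oriented)
  consider "u \<notin> \<rat>" "v \<notin> \<rat>" "w \<notin> \<rat>" | "u \<in> \<rat>" "v \<notin> \<rat>" "w \<notin> \<rat>" | "u \<notin> \<rat>" "v \<in> \<rat>" "w \<notin> \<rat>"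
    | "u \<notin> \<rat>" "v \<notin> \<rat>" "w \<in> \<rat>" | "u \<in> \<rat>" "v \<in> \<rat>" "w \<in> \<rat>"
    using third_root_rational R.third_root_rational S.third_root_rational by blast
  then show ?thesis
  proof cases
    case 1
    then show ?thesis by (intro that(1)) simp
  next
    case 2
    then show ?thesis by (intro that(2)[of u]) simp_all
  next
    case 3
    then show ?thesis by (intro that(2)[of v]) simp_all
  next
    case 4
    then show ?thesis by (intro that(2)[of w]) simp_all
  next
    case 5
    then show ?thesis by (intro that(3)) simp
  qed
qed

section \<open>The group structure in each case\<close>

lemma cyclic_3:
  assumes "{u, v, w} \<inter> \<rat> = {}" "is_square (cubic_disc F)"
  shows "card (Aut F) = 3" "Aut_generated_by F N \<and> Aut_group F \<cong> integer_mod_group 3"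
proof -
  have img: "complex_mat ` Aut F = {mat 1, N, N ** N}"
    using Aut_irreducible assms by simp
  then obtain n where n: "N = complex_mat n" "n \<in> Aut F"
    by blast
  have A: "Aut F = {mat 1, n, n ** n}"
    by (rule inj_image_eq_iff[OF inj_complex_mat, THEN iffD1]) (simp add: img n(1) complex_mat_1 complex_mat_mult)
  show card: "card (Aut F) = 3"
    using distinct_automorphisms unfolding card_complex_mat_image[of "Aut F", symmetric] img by simp
  interpret group GL2Q
    by (rule group_GL2Q)
  have nc: "n \<in> carrier GL2Q"
    using n(2) Aut_subset by blast
  have "complex_mat (n ** n ** n) = complex_mat (mat 1)"
    using N_cubed by (simp add: complex_mat_mult complex_mat_1 n(1))
  then have "n ** n ** n = mat 1"
    using inj_complex_mat by (simp only: inj_eq)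
  then have "n [^]\<^bsub>GL2Q\<^esub> (3::nat) = mat 1"
    by (simp add: numeral_3_eq_3 GL2Q_simps)
  moreover have "{0..<int 3} = {0, 1, 2}"
    by auto
  ultimately show "Aut_generated_by F N \<and> Aut_group F \<cong> integer_mod_group 3"
    unfolding n(1) using n(2) card nc by (intro Aut_cyclicI) (simp_all add: A int_pow_2 GL2Q_simps)
qed

lemma cyclic_2:
  assumes "{u, v, w} \<inter> \<rat> = {u}"
  shows "card (Aut F) = 2" "Aut_generated_by F (mat_T F u) \<and> Aut_group F \<cong> integer_mod_group 2"
proof -
  note img = Aut_one_root[OF assms]
  then obtain t where t: "mat_T F u = complex_mat t" "t \<in> Aut F"
    by blast
  have A: "Aut F = {mat 1, t}"
    by (rule inj_image_eq_iff[OF inj_complex_mat, THEN iffD1]) (simp add: img t(1) complex_mat_1)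
  show card: "card (Aut F) = 2"
    using distinct_automorphisms unfolding card_complex_mat_image[of "Aut F", symmetric] img by simp
  interpret group GL2Q
    by (rule group_GL2Q)
  have tc: "t \<in> carrier GL2Q"
    using t(2) Aut_subset by blast
  have "complex_mat (t ** t) = complex_mat (mat 1)"
    using T_squared by (simp add: complex_mat_mult complex_mat_1 t(1))
  then have "t ** t = mat 1"
    using inj_complex_mat by (simp only: inj_eq)
  then have "t [^]\<^bsub>GL2Q\<^esub> (2::nat) = mat 1"
    by (simp add: numeral_2_eq_2 GL2Q_simps)
  moreover have "{0..<int 2} = {0, 1}"
    by auto
  ultimately show "Aut_generated_by F (mat_T F u) \<and> Aut_group F \<cong> integer_mod_group 2"
    unfolding t(1) using t(2) card tc by (intro Aut_cyclicI) (simp_all add: A GL2Q_simps)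
qed

lemma cyclic_2_root:
  assumes "\<theta> \<in> {u, v, w}" "{u, v, w} \<inter> \<rat> = {\<theta>}"
  shows "card (Aut F) = 2 \<and> Aut_generated_by F (mat_T F \<theta>) \<and> Aut_group F \<cong> integer_mod_group 2"
proof -
  interpret R: oriented_cubic b3 b2 b1 b0 v w u
    by (rule rotate_oriented)
  interpret S: oriented_cubic b3 b2 b1 b0 w u v
    by (rule R.rotate_oriented)
  have sets: "{v, w, u} = {u, v, w}" "{w, u, v} = {u, v, w}"
    by auto
  from assms show ?thesis
    using cyclic_2 R.cyclic_2[unfolded sets] S.cyclic_2[unfolded sets] by auto
qed

lemma dihedral_3:
  assumes "{u, v, w} \<subseteq> \<rat>"
  shows "card (Aut F) = 6" "Aut_group F \<cong> dihedral_group 3"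
proof -
  note img = Aut_split[OF assms]
  then obtain n t where n: "N = complex_mat n" "n \<in> Aut F" and t: "mat_T F u = complex_mat t" "t \<in> Aut F"
    by blast
  \<comment> \<open>With \<open>n^2 t\<close> mapped to \<open>mat_T F v\<close> and
    \<open>n t\<close> to \<open>mat_T F w\<close>, the elements follow the order of
    \<open>img\<close>; \<open>dom\<close> below lists the exponents in the same order.\<close>
  have A: "Aut F = {mat 1, n, n ** n, t, n ** n ** t, n ** t}"
    by (rule inj_image_eq_iff[OF inj_complex_mat, THEN iffD1])
      (simp add: img complex_mat_1 complex_mat_mult N_mult_T NN_mult_T flip: n(1) t(1))
  show card: "card (Aut F) = 6"
    using distinct_automorphisms unfolding card_complex_mat_image[of "Aut F", symmetric] img by simp
  interpret group GL2Q
    by (rule group_GL2Q)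
  have c: "n \<in> carrier GL2Q" "t \<in> carrier GL2Q"
    using n(2) t(2) Aut_subset by blast+
  have "complex_mat (n ** n ** n) = complex_mat (mat 1)" "complex_mat (t ** t) = complex_mat (mat 1)"
    "complex_mat (t ** n) = complex_mat (n ** n ** t)"
    by (simp_all add: complex_mat_mult complex_mat_1 N_cubed T_squared T_mult_N NN_mult_T flip: n(1) t(1))
  then have rel: "n ** n ** n = mat 1" "t ** t = mat 1" "t ** n = n ** n ** t"
    using inj_complex_mat by (simp_all only: inj_eq)
  have n3: "n [^]\<^bsub>GL2Q\<^esub> (3::nat) = one GL2Q"
    using rel(1) by (simp add: numeral_3_eq_3 GL2Q_simps)
  have "inv\<^bsub>GL2Q\<^esub> n = n ** n"
    using rel(1) c m_closed[OF c(1) c(1)] by (intro inv_equality) (simp_all add: GL2Q_simps)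
  then have tn: "t \<otimes>\<^bsub>GL2Q\<^esub> n = inv\<^bsub>GL2Q\<^esub> n \<otimes>\<^bsub>GL2Q\<^esub> t"
    by (simp add: GL2Q_simps rel(3))
  let ?f = "\<lambda>(i::int, e). n [^]\<^bsub>GL2Q\<^esub> i \<otimes>\<^bsub>GL2Q\<^esub> (if e then t else one GL2Q)"
  have dom: "{0..<int 3} \<times> (UNIV :: bool set) =
    {(0, False), (1, False), (2, False), (0, True), (2, True), (1, True)}"
    by (auto simp: UNIV_bool)
  have f: "?f ` ({0..<int 3} \<times> UNIV) = Aut F"
    unfolding dom A using c by (simp add: int_pow_2 GL2Q_simps matrix_mul_lid matrix_mul_rid)
  have "inj_on ?f ({0..<int 3} \<times> UNIV)"
    by (rule eq_card_imp_inj_on) (unfold f card, simp_all add: card_cartesian_product)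
  then have "bij_betw ?f ({0..<int 3} \<times> UNIV) (Aut F)"
    unfolding bij_betw_def using f by blast
  then show "Aut_group F \<cong> dihedral_group 3"
    unfolding Aut_group_def
    by (intro iso_dihedral_group[OF c(1) n3 _ c(2) _ tn]) (simp_all add: GL2Q_simps rel(2))
qed

lemma Aut_trivial:
  assumes "{u, v, w} \<inter> \<rat> = {}" "\<not> is_square (cubic_disc F)"
  shows "Aut F = {mat 1}"
  by (rule inj_image_eq_iff[OF inj_complex_mat, THEN iffD1]) (simp add: Aut_irreducible assms complex_mat_1)

end

text \<open>The roots exist because the complex numbers are algebraically closed, and they differ
  because the discriminant is non-zero. The principal root and the product of differences have equal
  squares, so they agree after exchanging \<open>v\<close> and \<open>w\<close> if
  necessary.\<close>

lemma oriented_cubic_exists: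
  assumes b3: "b3 \<noteq> 0" and disc: "cubic_disc (Cubic b3 b2 b1 b0) \<noteq> 0"
  obtains u v w where "oriented_cubic b3 b2 b1 b0 u v w"
proof -
  define p :: "complex poly" where "p = [:of_int b0, of_int b1, of_int b2, of_int b3:]"
  have deg: "degree p = 3" and lead: "lead_coeff p = of_int b3" and "p \<noteq> 0"
    using b3 by (simp_all add: p_def)
  then obtain A where A: "size A = 3" "p = smult (of_int b3) (\<Prod>x\<in>#A. [:- x, 1:])"
    using alg_closed_imp_factorization[of p] by auto
  obtain u B where B: "A = {#u#} + B" "size B = 2"
    using A(1) unfolding numeral_3_eq_3 by (rule size_mset_SucE) simp
  obtain v C where C: "B = {#v#} + C" "size C = 1"
    using B(2) unfolding numeral_2_eq_2 by (rule size_mset_SucE) simp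
  obtain w where "C = {#w#}"
    using C(2) unfolding One_nat_def by (rule size_mset_SucE) simp
  with B C have "A = {#u, v, w#}"
    by simp
  then have "(\<Prod>x\<in>#A. [:- x, 1:]) = [:- u, 1:] * [:- v, 1:] * [:- w, 1:]"
    by (simp only: image_mset_add_mset prod_mset.add_mset image_mset_empty prod_mset_empty mult_1_right mult.assoc)
  with A(2) have p: "p = smult (of_int b3) ([:- u, 1:] * [:- v, 1:] * [:- w, 1:])"
    by (rule trans[OF _ arg_cong])
  have vieta: "[:- u, 1:] * [:- v, 1:] * [:- w, 1:] = [:- (u * v * w), u * v + v * w + w * u, - (u + v + w), 1:]"
    by (simp add: algebra_simps)
  have b: "of_int b2 = - of_int b3 * (u + v + w)" "of_int b1 = of_int b3 * (u * v + v * w + w * u)"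
    "of_int b0 = - of_int b3 * (u * v * w)"
    using p unfolding p_def vieta by (simp_all del: minus_add_distrib)
  note d = cubic_disc_factored[OF b]
  have "of_int (cubic_disc (Cubic b3 b2 b1 b0)) \<noteq> (0::complex)"
    using disc by simp
  then have dist: "u \<noteq> v" "v \<noteq> w" "w \<noteq> u"
    unfolding d by auto
  interpret factored_cubic b3 b2 b1 b0 u v w
    by unfold_locales (fact b3 b dist)+
  define s where "s = csqrt (- 3 * quadratic_disc (hessian F))"
  define V where "V = 3 * of_int b3 ^ 2 * ((u - v) * (v - w) * (w - u))"
  have "s\<^sup>2 = V\<^sup>2"
    unfolding s_def quadratic_disc_hessian d V_def by (simp add: power_mult_distrib)
  then consider "s = V" | "s = - V"
    unfolding power2_eq_iff by blast
  then show ?thesis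
  proof cases
    case 1
    then show ?thesis
      unfolding s_def V_def
      by (intro that[of u v w] oriented_cubic.intro factored_cubic_axioms oriented_cubic_axioms.intro)
  next
    case 2
    moreover have "- V = 3 * of_int b3 ^ 2 * ((u - w) * (w - v) * (v - u))"
      by (simp add: V_def algebra_simps)
    ultimately show ?thesis
      unfolding s_def
      by (intro that[of u w v] oriented_cubic.intro swap oriented_cubic_axioms.intro) simp
  qed
qed

theorem theorem3p1:
  fixes F :: int_cubic and b3 b2 b1 b0 :: int
  assumes "F = Cubic b3 b2 b1 b0" and "b3 \<noteq> 0" and "cubic_disc F \<noteq> 0"
  shows
    "(Aut F = {mat 1} \<longleftrightarrow> irreducible (form F) \<and> \<not> is_square (cubic_disc F))
     \<and>
     (Aut_generated_by F (mat_N (hessian F)) \<and> Aut_group F \<cong> integer_mod_group 3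
        \<longleftrightarrow> irreducible (form F) \<and> is_square (cubic_disc F))
     \<and>
     (\<forall>\<theta>::complex. eval_cubic F \<theta> 1 = 0 \<longrightarrow>
        (Aut_generated_by F (mat_T F \<theta>) \<and> Aut_group F \<cong> integer_mod_group 2
           \<longleftrightarrow> sole_rational_linear_factor F \<theta>) \<and>
        (sole_rational_linear_factor F \<theta>
           \<longrightarrow> {\<eta>. eval_cubic F \<eta> 1 = 0 \<and> \<eta> \<in> \<rat>} = {\<theta>}))
     \<and>
     (\<forall>\<theta>\<^sub>1 \<theta>\<^sub>2 \<theta>\<^sub>3 :: complex. {\<theta>. eval_cubic F \<theta> 1 = 0} = {\<theta>\<^sub>1, \<theta>\<^sub>2, \<theta>\<^sub>3} \<longrightarrow>
        (complex_mat ` Aut F =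
             {mat 1, mat_N (hessian F), mat_N (hessian F) ** mat_N (hessian F),
              mat_T F \<theta>\<^sub>1, mat_T F \<theta>\<^sub>2, mat_T F \<theta>\<^sub>3} \<and>
         Aut_group F \<cong> dihedral_group 3
           \<longleftrightarrow> splits_over_rat F))"
proof -
  note F = assms(1)
  obtain u v w where "oriented_cubic b3 b2 b1 b0 u v w"
    using oriented_cubic_exists assms by metis
  then interpret oriented_cubic b3 b2 b1 b0 u v w .
  let ?Q = "{u, v, w} \<inter> \<rat>"
  have iso: "card (Aut F) = 3" if "Aut_group F \<cong> integer_mod_group 3"
    using iso_same_card[OF that] by (simp add: Aut_group_def carrier_integer_mod_group)
  have iso2: "card (Aut F) = 2" if "Aut_group F \<cong> integer_mod_group 2"
    using iso_same_card[OF that] by (simp add: Aut_group_def carrier_integer_mod_group)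
  have iso6: "card (Aut F) = 6" if "Aut_group F \<cong> dihedral_group 3"
    using iso_same_card[OF that] by (simp add: Aut_group_def dihedral_group_def card_cartesian_product)
  \<comment> \<open>The four cases have the distinct orders 1, 3, 2 and 6, so the order of the group
    identifies the case. This drives the implications from the group to the factorisation.\<close>
  have card: "card (Aut F) = 1 \<and> ?Q = {} \<and> \<not> is_square (cubic_disc F) \<or>
    card (Aut F) = 3 \<and> ?Q = {} \<and> is_square (cubic_disc F) \<or>
    card (Aut F) = 2 \<and> (\<exists>\<theta>. ?Q = {\<theta>}) \<or> card (Aut F) = 6 \<and> {u, v, w} \<subseteq> \<rat>"
  proof (cases rule: rational_roots_cases)
    case 1
    then show ?thesis
      using Aut_trivial cyclic_3(1) F by (cases "is_square (cubic_disc F)") auto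
  next
    case (2 \<theta>)
    then show ?thesis
      using cyclic_2_root F by blast
  next
    case 3
    then show ?thesis
      using dihedral_3(1) F by blast
  qed
  have one: "Aut F = {mat 1} \<longleftrightarrow> irreducible (form F) \<and> \<not> is_square (cubic_disc F)"
    using card Aut_trivial unfolding F irreducible_iff by auto
  have two: "Aut_generated_by F (mat_N (hessian F)) \<and> Aut_group F \<cong> integer_mod_group 3
      \<longleftrightarrow> irreducible (form F) \<and> is_square (cubic_disc F)"
    using card iso cyclic_3(2) unfolding F irreducible_iff by auto
  have three: "Aut_generated_by F (mat_T F \<theta>) \<and> Aut_group F \<cong> integer_mod_group 2 \<longleftrightarrow> sole_rational_linear_factor F \<theta>"
    "sole_rational_linear_factor F \<theta> \<longrightarrow> {\<eta>. eval_cubic F \<eta> 1 = 0 \<and> \<eta> \<in> \<rat>} = {\<theta>}"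
    if "eval_cubic F \<theta> 1 = 0" for \<theta> :: complex
  proof -
    have \<theta>: "\<theta> \<in> {u, v, w}"
      using that unfolding F eval_F_eq_0_iff .
    \<comment> \<open>Order 2 leaves a single rational root; it is \<open>\<theta>\<close> because a
      generator \<open>mat_T F \<theta>\<close> is rational.\<close>
    have "?Q = {\<theta>}" if gen: "Aut_generated_by F (mat_T F \<theta>)" "Aut_group F \<cong> integer_mod_group 2"
    proof -
      have "mat_T F \<theta> \<in> range complex_mat"
        using gen(1) unfolding Aut_generated_by_def by (metis rangeI)
      then have "\<theta> \<in> ?Q"
        using T_rational_iff[OF \<theta>] \<theta> unfolding F by blast
      moreover obtain \<eta> where "?Q = {\<eta>}"
        using card iso2[OF gen(2)] by auto
      ultimately show ?thesis
        by simp
    qed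
    then show "Aut_generated_by F (mat_T F \<theta>) \<and> Aut_group F \<cong> integer_mod_group 2 \<longleftrightarrow> sole_rational_linear_factor F \<theta>"
      using cyclic_2_root[OF \<theta>] unfolding F sole_iff by blast
    show "sole_rational_linear_factor F \<theta> \<longrightarrow> {\<eta>. eval_cubic F \<eta> 1 = 0 \<and> \<eta> \<in> \<rat>} = {\<theta>}"
      unfolding F sole_iff eval_F_eq_0_iff by blast
  qed
  have four: "complex_mat ` Aut F =
           {mat 1, mat_N (hessian F), mat_N (hessian F) ** mat_N (hessian F), mat_T F \<theta>1, mat_T F \<theta>2, mat_T F \<theta>3} \<and>
         Aut_group F \<cong> dihedral_group 3 \<longleftrightarrow> splits_over_rat F"
    if roots: "{\<theta>. eval_cubic F \<theta> 1 = 0} = {\<theta>1, \<theta>2, \<theta>3}" for \<theta>1 \<theta>2 \<theta>3 :: complex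
  proof -
    have "{\<theta>1, \<theta>2, \<theta>3} = {u, v, w}"
      using roots unfolding F eval_F_eq_0_iff Collect_mem_eq by (rule sym)
    \<comment> \<open>The given roots may come in another order than \<open>u, v, w\<close>, so the
      matrices are compared as sets.\<close>
    then have "mat_T F ` {\<theta>1, \<theta>2, \<theta>3} = mat_T F ` {u, v, w}"
      by simp
    then have T: "{mat_T F \<theta>1, mat_T F \<theta>2, mat_T F \<theta>3} = {mat_T F u, mat_T F v, mat_T F w}"
      by simp
    have imp: "splits_over_rat F" if "Aut_group F \<cong> dihedral_group 3"
      using iso6[OF that] card unfolding F splits_iff by auto
    have img: "complex_mat ` Aut F = {mat 1, mat_N (hessian F), mat_N (hessian F) ** mat_N (hessian F),
        mat_T F \<theta>1, mat_T F \<theta>2, mat_T F \<theta>3}" if "splits_over_rat F"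
      unfolding T unfolding F by (rule Aut_split) (use that in \<open>unfold F splits_iff\<close>)
    have dih: "Aut_group F \<cong> dihedral_group 3" if "splits_over_rat F"
      unfolding F by (rule dihedral_3(2)) (use that in \<open>unfold F splits_iff\<close>)
    show ?thesis
      by (rule iffI, erule conjE, erule imp) (intro conjI img dih)
  qed
  show ?thesis
    using one two three four by blast
qed

end
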